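(* Let $t>0$ be an integer. There is a constant $C_t$ such that the following holds. Let $P$ be an $x$-monotone simple polygon and let $V$ be a set of $n$ points on its boundary. If the visibility graph of $V$ with respect to $P$ does not contain $K_{t,t}$ as a subgraph, then it has at most $C_t n$ edges.
   Context: A simple polygon is $x$-monotone if every vertical line intersects its boundary at most twice. Two points $p,q\in P$ see each other if the segment $\overline{pq}$ is disjoint from the exterior of $P$. The visibility graph of a set $V$ of points on the boundary of $P$ with respect to $P$ has vertex set $V$, with two points adjacent iff they see each other. *)

theory Defs
  imports "HOL-Analysis.Analysis"
begin

type_synonym pt = "real \<times> real"

text \<open>A polygon is given by its cyclic list of vertices; edge i joins vertex i to vertex i+1 (mod n).\<close>

definition poly_edge :: "pt list \<Rightarrow> nat \<Rightarrow> pt set" where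
  "poly_edge vs i = closed_segment (vs ! i) (vs ! ((i + 1) mod length vs))"

definition poly_boundary :: "pt list \<Rightarrow> pt set" where
  "poly_boundary vs = (\<Union>i<length vs. poly_edge vs i)"

definition simple_polygon :: "pt list \<Rightarrow> bool" where
  "simple_polygon vs \<longleftrightarrow>
     length vs \<ge> 3 \<and> distinct vs \<and>
     (\<forall>i<length vs. \<forall>j<length vs. i \<noteq> j \<longrightarrow>
        (if j = (i + 1) mod length vs then poly_edge vs i \<inter> poly_edge vs j = {vs ! j}
         else if i = (j + 1) mod length vs then poly_edge vs i \<inter> poly_edge vs j = {vs ! i}
         else poly_edge vs i \<inter> poly_edge vs j = {}))"

definition poly_region :: "pt list \<Rightarrow> pt set" where
  "poly_region vs = poly_boundary vs \<union> inside (poly_boundary vs)"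

definition x_monotone :: "pt list \<Rightarrow> bool" where
  "x_monotone vs \<longleftrightarrow>
     (\<forall>a::real. finite {p \<in> poly_boundary vs. fst p = a} \<and>
                card {p \<in> poly_boundary vs. fst p = a} \<le> 2)"

definition sees :: "pt list \<Rightarrow> pt \<Rightarrow> pt \<Rightarrow> bool" where
  "sees vs p q \<longleftrightarrow> closed_segment p q \<inter> (- poly_region vs) = {}"

definition vis_edges :: "pt list \<Rightarrow> pt set \<Rightarrow> pt set set" where
  "vis_edges vs V = {{p, q} | p q. p \<in> V \<and> q \<in> V \<and> p \<noteq> q \<and> sees vs p q}"

definition contains_Ktt :: "pt list \<Rightarrow> pt set \<Rightarrow> nat \<Rightarrow> bool" where
  "contains_Ktt vs V t \<longleftrightarrow>
     (\<exists>A B. A \<subseteq> V \<and> B \<subseteq> V \<and> A \<inter> B = {} \<and> card A = t \<and> card B = t \<and>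
            (\<forall>a\<in>A. \<forall>b\<in>B. {a, b} \<in> vis_edges vs V))"

end

theory Submission
  imports Defs
begin

text \<open>
  An \<open>x\<close>-monotone polygon is the region between the graphs of two functions \<open>l\<close> and \<open>u\<close>. Record an
  edge with left end at abscissa \<open>x\<close> and right end at abscissa \<open>y\<close> as the matrix entry \<open>(-x, y)\<close>, so
  that larger coordinates mean longer edges.

  Let \<open>p\<close> lie on the lower chain and \<open>q\<close> to its right on the upper chain. Then \<open>p\<close> sees \<open>q\<close> as soon as
  \<open>p\<close> sees some upper point beyond \<open>q\<close> and \<open>q\<close> sees some lower point beyond \<open>p\<close>. For two points of the
  upper chain, crossing edges produce the edge joining their outer ends as soon as some edge spans
  all four points.

  In both cases delete at every vertex its \<open>k\<close> longest edges, which costs linearly many. Each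
  remaining edge \<open>(i, j)\<close> comes with the next \<open>k\<close> entries of its column and of its row. If they do
  not span a biclique, then the row or column of one of them stops early, and the edge is charged to
  that row or column; the closure property bounds the number of charges. Within one chain this works
  only when the left ends all precede the right ends. The points are therefore split into blocks
  such that each block is spanned by an edge and no edge skips a block, and edges inside a block and
  edges between consecutive blocks are counted separately. The lower chain is symmetric.
\<close>

section \<open>Counting in finite relations on the reals\<close>

lemma card_le_mult_of_fibers:
  assumes "finite A" "\<And>e. e \<in> E \<Longrightarrow> f e \<in> A"
    and "\<And>a. a \<in> A \<Longrightarrow> card {e \<in> E. f e = a} \<le> k" and "finite E"
  shows "card E \<le> k * card A"
proof -
  have "E = (\<Union>a\<in>A. {e \<in> E. f e = a})" using assms(2) by auto
  then have "card E \<le> (\<Sum>a\<in>A. card {e \<in> E. f e = a})"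
    using card_UN_le[OF assms(1), of "\<lambda>a. {e \<in> E. f e = a}"] by simp
  also have "\<dots> \<le> (\<Sum>a\<in>A. k)" using assms(3) by (intro sum_mono)
  finally show ?thesis by (simp add: mult.commute)
qed

text \<open>The lowest such element has fewer than \<open>k\<close> elements of \<open>S\<close>
  above it, and all the others are among these. Most charges below are bounded by exhibiting them as
  the last \<open>k\<close> in some order.\<close>

lemma card_few_above_le:
  fixes f :: "'a \<Rightarrow> real"
  assumes "finite S" "inj_on f S"
  shows "card {x \<in> S. card {y \<in> S. f x < f y} < k} \<le> k"
proof (cases "{x \<in> S. card {y \<in> S. f x < f y} < k} = {}")
  case False
  let ?T = "{x \<in> S. card {y \<in> S. f x < f y} < k}"
  have fin: "finite ?T" using assms by simp
  obtain x where x: "x \<in> ?T" "\<And>y. y \<in> ?T \<Longrightarrow> f x \<le> f y"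
    using ex_is_arg_min_if_finite[OF fin False, of f]
    by (auto simp: is_arg_min_linorder)
  have "?T \<subseteq> insert x {y \<in> S. f x < f y}"
  proof
    fix y assume y: "y \<in> ?T"
    then have "f x \<le> f y" using x(2) by blast
    moreover have "f x = f y \<Longrightarrow> x = y" using x(1) y assms(2) by (auto simp: inj_on_def)
    ultimately show "y \<in> insert x {y \<in> S. f x < f y}" using y by force
  qed
  then have "card ?T \<le> card (insert x {y \<in> S. f x < f y})"
    using assms by (intro card_mono) auto
  also have "\<dots> \<le> Suc (card {y \<in> S. f x < f y})" by (rule card_insert_le_m1) auto
  also have "\<dots> \<le> k" using x(1) by simp
  finally show ?thesis .
next
  case True
  show ?thesis unfolding True by simp
qed

text \<open>\<open>J\<close> is element number \<open>Suc k\<close> above \<open>x\<close>, counted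
  upwards; the induction passes from one such element to the next element of
  \<open>S\<close>.\<close>

lemma ex_kth_above:
  fixes S :: "real set"
  assumes "finite S" "Suc k \<le> card {y \<in> S. x < y}"
  shows "\<exists>J\<in>S. x < J \<and> card {y \<in> S. x < y \<and> y < J} = k"
  using assms(2)
proof (induction k)
  case 0
  let ?T = "{y \<in> S. x < y}"
  have "?T \<noteq> {}" using 0 by force
  then have "Min ?T \<in> ?T" "\<And>y. y \<in> ?T \<Longrightarrow> Min ?T \<le> y"
    using assms(1) Min_in[of ?T] by simp_all
  moreover from this have "{y \<in> S. x < y \<and> y < Min ?T} = {}" by force
  then have "card {y \<in> S. x < y \<and> y < Min ?T} = 0" by (simp only: card.empty)
  ultimately show ?case by blast
next
  case (Suc k)
  then obtain J where J: "J \<in> S" "x < J" "card {y \<in> S. x < y \<and> y < J} = k" by auto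
  let ?T = "{y \<in> S. J < y}"
  have "?T \<noteq> {}"
  proof
    assume "?T = {}"
    then have "{y \<in> S. x < y} \<subseteq> insert J {y \<in> S. x < y \<and> y < J}" by force
    then have "card {y \<in> S. x < y} \<le> card (insert J {y \<in> S. x < y \<and> y < J})"
      using assms(1) by (intro card_mono) auto
    then show False using Suc.prems J(3) assms(1) by (simp add: card_insert_if)
  qed
  then have M: "Min ?T \<in> ?T" "\<And>y. y \<in> ?T \<Longrightarrow> Min ?T \<le> y"
    using assms(1) Min_in[of ?T] by simp_all
  then have "{y \<in> S. x < y \<and> y < Min ?T} = insert J {y \<in> S. x < y \<and> y < J}"
    using J by force
  then have "card {y \<in> S. x < y \<and> y < Min ?T} = Suc k" using J(3) assms(1) by simp
  then show ?case using M J by (intro bexI[of _ "Min ?T"]) auto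
qed

section \<open>Biclique-free relations and their deep entries\<close>

definition biclique_free :: "(real \<times> real) set \<Rightarrow> nat \<Rightarrow> bool" where
  "biclique_free E k \<longleftrightarrow> \<not> (\<exists>A B. card A = k \<and> card B = k \<and> A \<times> B \<subseteq> E)"

definition above_in_col :: "(real \<times> real) set \<Rightarrow> real \<Rightarrow> real \<Rightarrow> real set" where
  "above_in_col E i j = {i'. (i', j) \<in> E \<and> i < i'}"

definition above_in_row :: "(real \<times> real) set \<Rightarrow> real \<Rightarrow> real \<Rightarrow> real set" where
  "above_in_row E i j = {j'. (i, j') \<in> E \<and> j < j'}"

text \<open>What is left after the \<open>k\<close> largest entries of every row and of every column
  have been deleted.\<close>

definition deep :: "(real \<times> real) set \<Rightarrow> nat \<Rightarrow> (real \<times> real) set" where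
  "deep E k = {(i, j) \<in> E. k \<le> card (above_in_col E i j) \<and> k \<le> card (above_in_row E i j)}"

lemma finite_col: "finite E \<Longrightarrow> finite {i. (i, j) \<in> E \<and> P i}"
  by (rule finite_subset[of _ "fst ` E"]) force+

lemma finite_row: "finite E \<Longrightarrow> finite {j. (i, j) \<in> E \<and> P j}"
  by (rule finite_subset[of _ "snd ` E"]) force+

lemma finite_col': "finite E \<Longrightarrow> finite {i. (i, j) \<in> E}"
  by (rule finite_subset[of _ "fst ` E"]) force+

lemma finite_row': "finite E \<Longrightarrow> finite {j. (i, j) \<in> E}"
  by (rule finite_subset[of _ "snd ` E"]) force+

lemma card_shallow_rows:
  assumes "finite E"
  shows "card {(i, j) \<in> E. card (above_in_row E i j) < k} \<le> k * card (fst ` E)"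
proof (rule card_le_mult_of_fibers[where f = fst])
  fix i assume "i \<in> fst ` E"
  let ?S = "{j. (i, j) \<in> E}"
  have "{e \<in> {(i, j) \<in> E. card (above_in_row E i j) < k}. fst e = i}
      \<subseteq> Pair i ` {j \<in> ?S. card {j' \<in> ?S. j < j'} < k}"
    by (auto simp: above_in_row_def)
  then have "card {e \<in> {(i, j) \<in> E. card (above_in_row E i j) < k}. fst e = i}
      \<le> card {j \<in> ?S. card {j' \<in> ?S. j < j'} < k}"
    using finite_row'[OF assms] by (intro surj_card_le) auto
  also have "\<dots> \<le> k"
    using card_few_above_le[of ?S "\<lambda>x. x" k] finite_row'[OF assms] by simp
  finally show "card {e \<in> {(i, j) \<in> E. card (above_in_row E i j) < k}. fst e = i} \<le> k" .
next
  show "finite {(i, j) \<in> E. card (above_in_row E i j) < k}"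
    by (rule finite_subset[OF _ assms]) auto
qed (use assms in force)+

lemma above_in_row_converse: "above_in_row (E\<inverse>) j i = above_in_col E i j"
  by (auto simp: above_in_row_def above_in_col_def)

lemma fst_converse: "fst ` (E\<inverse>) = snd ` E"
  by force

lemma card_shallow_cols:
  assumes "finite E"
  shows "card {(i, j) \<in> E. card (above_in_col E i j) < k} \<le> k * card (snd ` E)"
proof -
  have "{(i, j) \<in> E. card (above_in_col E i j) < k}
      = ({(j, i) \<in> E\<inverse>. card (above_in_row (E\<inverse>) j i) < k})\<inverse>"
    by (auto simp: above_in_row_converse)
  then show ?thesis
    using card_shallow_rows[of "E\<inverse>" k] assms by (simp add: fst_converse)
qed

lemma card_le_deep:
  assumes "finite E"
  shows "card E \<le> k * (card (fst ` E) + card (snd ` E)) + card (deep E k)"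
proof -
  let ?R = "{(i, j) \<in> E. card (above_in_row E i j) < k}"
  let ?C = "{(i, j) \<in> E. card (above_in_col E i j) < k}"
  have fin: "finite (?R \<union> ?C \<union> deep E k)"
    by (rule finite_subset[OF _ assms]) (auto simp: deep_def)
  have "E \<subseteq> ?R \<union> ?C \<union> deep E k" by (auto simp: deep_def)
  then have "card E \<le> card (?R \<union> ?C \<union> deep E k)" using fin by (rule card_mono[rotated])
  also have "\<dots> \<le> card ?R + card ?C + card (deep E k)"
    by (meson add_le_mono1 card_Un_le le_trans)
  finally show ?thesis
    using card_shallow_rows[OF assms, of k] card_shallow_cols[OF assms, of k]
    by (simp add: algebra_simps)
qed

text \<open>The \<open>Suc\<close> in front of the number of entries strictly in between makes
  \<open>I\<close> exactly the \<open>k\<close>-th next entry of the column, and \<open>J\<close>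
  that of the row.\<close>

lemma deep_obtain_kth:
  assumes "finite E" "0 < k" "(i, j) \<in> deep E k"
  obtains I J where "(I, j) \<in> E" "i < I" "Suc (card {i'. (i', j) \<in> E \<and> i < i' \<and> i' < I}) = k"
    "(i, J) \<in> E" "j < J" "Suc (card {j'. (i, j') \<in> E \<and> j < j' \<and> j' < J}) = k"
proof -
  obtain m where m: "k = Suc m" using assms(2) by (cases k) auto
  obtain I where "I \<in> {i. (i, j) \<in> E}" "i < I"
      "card {y \<in> {i. (i, j) \<in> E}. i < y \<and> y < I} = m"
    using ex_kth_above[of "{i. (i, j) \<in> E}" m i] finite_col'[OF assms(1), of j] assms(3)
    by (auto simp: deep_def above_in_col_def m)
  moreover obtain J where "J \<in> {j. (i, j) \<in> E}" "j < J"
      "card {y \<in> {j. (i, j) \<in> E}. j < y \<and> y < J} = m"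
    using ex_kth_above[of "{j. (i, j) \<in> E}" m j] finite_row'[OF assms(1), of i] assms(3)
    by (auto simp: deep_def above_in_row_def m)
  ultimately show thesis using that[of I J] m by simp
qed

lemma card_insert_between:
  fixes a J :: real
  assumes "P J" "a < J" "finite {x. P x \<and> a < x \<and> x < J}"
  shows "card {x. P x \<and> a < x \<and> x \<le> J} = Suc (card {x. P x \<and> a < x \<and> x < J})"
proof -
  have "{x. P x \<and> a < x \<and> x \<le> J} = insert J {x. P x \<and> a < x \<and> x < J}" using assms by auto
  then show ?thesis using assms by simp
qed

text \<open>The \<open>k\<close> next entries of the column, up to and including \<open>I\<close>,
  and the \<open>k\<close> next entries of the row, up to and including \<open>J\<close>, would
  otherwise span a biclique. So some corner \<open>(i', j')\<close> is missing.\<close>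

lemma biclique_free_kth:
  assumes "finite E" "biclique_free E k"
    and "(I, j) \<in> E" "i < I" "Suc (card {i'. (i', j) \<in> E \<and> i < i' \<and> i' < I}) = k"
    and "(i, J) \<in> E" "j < J" "Suc (card {j'. (i, j') \<in> E \<and> j < j' \<and> j' < J}) = k"
  obtains i' j' where "(i', j) \<in> E" "i < i'" "i' \<le> I" "(i, j') \<in> E" "j < j'" "j' \<le> J" "(i', j') \<notin> E"
proof -
  let ?A = "{i'. (i', j) \<in> E \<and> i < i' \<and> i' \<le> I}"
  let ?B = "{j'. (i, j') \<in> E \<and> j < j' \<and> j' \<le> J}"
  have "card ?A = k"
    using card_insert_between[of "\<lambda>i. (i, j) \<in> E" I i] assms finite_col[OF assms(1)] by simp
  moreover have "card ?B = k"
    using card_insert_between[of "\<lambda>j. (i, j) \<in> E" J j] assms finite_row[OF assms(1)] by simp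
  ultimately have "\<not> ?A \<times> ?B \<subseteq> E" using assms(2) unfolding biclique_free_def by blast
  then show thesis using that by blast
qed

section \<open>Edges between the lower and the upper chain\<close>

text \<open>
  Charge \<open>(i, j)\<close> to the row \<open>I\<close> that stops before \<open>J\<close>. All columns charged to \<open>I\<close> are entries of row \<open>I\<close>,
  so by the closure property they also occur in the row \<open>i\<close> of the leftmost charge, before \<open>J\<close>.
\<close>

lemma card_early_rows_le:
  fixes E :: "(real \<times> real) set"
  assumes fin: "finite E" and pos: "\<And>i j. (i, j) \<in> E \<Longrightarrow> 0 < i + j"
    and closure: "\<And>i j i' j'. (i', j) \<in> E \<Longrightarrow> (i, j') \<in> E \<Longrightarrow> i \<le> i' \<Longrightarrow> j \<le> j' \<Longrightarrow> 0 < i + j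
      \<Longrightarrow> (i, j) \<in> E"
    and T: "T \<subseteq> E"
    and row: "\<And>i j. (i, j) \<in> T \<Longrightarrow> \<exists>I J. (I, j) \<in> E \<and> i < I \<and> card {i'. (i', j) \<in> E \<and> i < i' \<and> i' < I} < k
      \<and> (i, J) \<in> E \<and> j < J \<and> card {j'. (i, j') \<in> E \<and> j < j' \<and> j' < J} < k
      \<and> (\<forall>j'. (I, j') \<in> E \<longrightarrow> j' < J)"
  shows "card T \<le> k * k * card (fst ` E)"
proof -
  \<comment> \<open>\<open>Q e I\<close> is the hypothesis \<open>row\<close> for the entry
    \<open>e\<close> with its first witness exposed, so that \<open>I\<close> can be chosen as the
    row to charge.\<close>
  define Q where "Q e I \<longleftrightarrow> (\<exists>J. (I, snd e) \<in> E \<and> fst e < I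
      \<and> card {i'. (i', snd e) \<in> E \<and> fst e < i' \<and> i' < I} < k
      \<and> (fst e, J) \<in> E \<and> snd e < J \<and> card {j'. (fst e, j') \<in> E \<and> snd e < j' \<and> j' < J} < k
      \<and> (\<forall>j'. (I, j') \<in> E \<longrightarrow> j' < J))" for e :: "real \<times> real" and I
  have "\<exists>I. Q e I" if "e \<in> T" for e
    using row[of "fst e" "snd e"] that unfolding Q_def by simp
  then obtain \<iota> where \<iota>: "\<And>e. e \<in> T \<Longrightarrow> Q e (\<iota> e)" by metis
  have finT: "finite T" using fin T finite_subset by blast
  show ?thesis
  proof (rule card_le_mult_of_fibers[where f = \<iota>])
    show "finite (fst ` E)" "finite T" using fin finT by auto
    show "\<iota> e \<in> fst ` E" if "e \<in> T" for e using \<iota>[OF that] by (force simp: Q_def)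
  next
    fix I
    define X where "X = {e \<in> T. \<iota> e = I}"
    have finX: "finite X" using finT by (simp add: X_def)
    have QX: "Q e I" if "e \<in> X" for e using \<iota>[of e] that by (simp add: X_def)
    \<comment> \<open>A charge has fewer than \<open>k\<close> entries of its column between itself
      and \<open>I\<close>, so each column holds at most \<open>k\<close> charges to
      \<open>I\<close>.\<close>
    have "card X \<le> k * card (snd ` X)"
    proof (rule card_le_mult_of_fibers[where f = snd])
      fix j assume "j \<in> snd ` X"
      let ?S = "{i. (i, j) \<in> E \<and> i < I}"
      have "{e \<in> X. snd e = j} \<subseteq> (\<lambda>i. (i, j)) ` {i \<in> ?S. card {i' \<in> ?S. i < i'} < k}"
      proof
        fix e assume e: "e \<in> {e \<in> X. snd e = j}"
        then obtain i where i: "e = (i, j)" by (cases e) auto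
        have "Q (i, j) I" using QX e i by auto
        moreover have "{i' \<in> ?S. i < i'} = {i'. (i', j) \<in> E \<and> i < i' \<and> i' < I}" by auto
        moreover have "(i, j) \<in> E" using e i T by (auto simp: X_def)
        ultimately show "e \<in> (\<lambda>i. (i, j)) ` {i \<in> ?S. card {i' \<in> ?S. i < i'} < k}"
          using i by (auto simp: Q_def)
      qed
      then have "card {e \<in> X. snd e = j} \<le> card {i \<in> ?S. card {i' \<in> ?S. i < i'} < k}"
        using finite_col[OF fin] by (intro surj_card_le) auto
      also have "\<dots> \<le> k"
        using card_few_above_le[of ?S "\<lambda>x. x" k] finite_col[OF fin] by simp
      finally show "card {e \<in> X. snd e = j} \<le> k" .
    qed (use finX in auto)
    also have "card (snd ` X) \<le> k"
    proof (cases "X = {}")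
      case False
      then have "Min (snd ` X) \<in> snd ` X" using finX by (intro Min_in) auto
      then obtain i0 j0 where 0: "(i0, j0) \<in> X" "j0 = Min (snd ` X)" by force
      obtain J where J: "i0 < I" "(i0, J) \<in> E" "j0 < J"
          "card {j'. (i0, j') \<in> E \<and> j0 < j' \<and> j' < J} < k" "\<And>j'. (I, j') \<in> E \<Longrightarrow> j' < J"
        using QX[OF 0(1)] by (auto simp: Q_def)
      have "snd ` X \<subseteq> insert j0 {j'. (i0, j') \<in> E \<and> j0 < j' \<and> j' < J}"
      proof
        fix j assume "j \<in> snd ` X"
        then obtain i where ij: "(i, j) \<in> X" by force
        have le: "j0 \<le> j" using ij 0(2) finX by (metis Min_le \<open>j \<in> snd ` X\<close> finite_imageI)
        have Ij: "(I, j) \<in> E" using QX[OF ij] by (simp add: Q_def)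
        have "(i0, j0) \<in> E" using 0(1) T by (auto simp: X_def)
        then have "0 < i0 + j" using pos le by force
        then have "(i0, j) \<in> E" using closure[OF Ij J(2)] J(1) J(5)[OF Ij] by simp
        then show "j \<in> insert j0 {j'. (i0, j') \<in> E \<and> j0 < j' \<and> j' < J}"
          using le J(5)[OF Ij] by auto
      qed
      then have "card (snd ` X) \<le> card (insert j0 {j'. (i0, j') \<in> E \<and> j0 < j' \<and> j' < J})"
        using finite_row[OF fin] by (intro card_mono) auto
      also have "\<dots> \<le> k" using J(4) finite_row[OF fin] by (simp add: card_insert_if)
      finally show ?thesis .
    qed simp
    finally show "card {e \<in> T. \<iota> e = I} \<le> k * k" unfolding X_def by simp
  qed
qed

text \<open>A deep entry has a missing corner \<open>(i', j')\<close>. If row \<open>i'\<close>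
  reached \<open>J\<close> and column \<open>j'\<close> reached \<open>I\<close>, the closure
  property would supply this corner. So row \<open>i'\<close> stops before \<open>J\<close>, or
  column \<open>j'\<close> stops before \<open>I\<close>; the second case is the first one for the
  converse relation.\<close>

lemma card_biclique_free_hooks:
  fixes E :: "(real \<times> real) set"
  assumes fin: "finite E" and "0 < k" and free: "biclique_free E k"
    and pos: "\<And>i j. (i, j) \<in> E \<Longrightarrow> 0 < i + j"
    and closure: "\<And>i j i' j'. (i', j) \<in> E \<Longrightarrow> (i, j') \<in> E \<Longrightarrow> i \<le> i' \<Longrightarrow> j \<le> j' \<Longrightarrow> 0 < i + j
      \<Longrightarrow> (i, j) \<in> E"
  shows "card E \<le> (k + k * k) * (card (fst ` E) + card (snd ` E))"
proof -
  \<comment> \<open>The relation is an argument of \<open>P\<close> and \<open>T\<close> so that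
    both can be applied to \<open>E\<close> and to its converse.\<close>
  define P where "P E i j I J \<longleftrightarrow>
    (I, j) \<in> E \<and> i < I \<and> card {i'. (i', j) \<in> E \<and> i < i' \<and> i' < I} < k
      \<and> (i, J) \<in> E \<and> j < J \<and> card {j'. (i, j') \<in> E \<and> j < j' \<and> j' < J} < k
      \<and> (\<forall>j'. (I, j') \<in> E \<longrightarrow> j' < J)" for E :: "(real \<times> real) set" and i j I J
  define T where "T E = {(i, j) \<in> E. \<exists>I J. P E i j I J}" for E
  have T: "card (T E) \<le> k * k * card (fst ` E)"
  proof (rule card_early_rows_le[where k = k, OF fin])
    show "0 < i + j" if "(i, j) \<in> E" for i j using pos[OF that] .
    show "(i, j) \<in> E" if "(i', j) \<in> E" "(i, j') \<in> E" "i \<le> i'" "j \<le> j'" "0 < i + j" for i j i' j'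
      using closure that .
  qed (unfold T_def P_def, blast+)
  have T': "card (T (E\<inverse>)) \<le> k * k * card (fst ` (E\<inverse>))"
  proof (rule card_early_rows_le[where k = k])
    show "0 < j + i" if "(j, i) \<in> E\<inverse>" for i j using pos[of i j] that by simp
    show "(j, i) \<in> E\<inverse>" if "(j', i) \<in> E\<inverse>" "(j, i') \<in> E\<inverse>" "j \<le> j'" "i \<le> i'" "0 < j + i" for i j i' j'
      using closure[of i' j i j'] that by simp
    show "finite (E\<inverse>)" using fin by simp
  qed (unfold T_def P_def, blast+)
  have "deep E k \<subseteq> T E \<union> (T (E\<inverse>))\<inverse>"
  proof
    fix e assume e: "e \<in> deep E k"
    obtain i j where ij: "e = (i, j)" "(i, j) \<in> deep E k" "(i, j) \<in> E"
      using e by (cases e) (auto simp: deep_def)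
    obtain I J where I: "(I, j) \<in> E" "i < I" "Suc (card {i'. (i', j) \<in> E \<and> i < i' \<and> i' < I}) = k"
      and J: "(i, J) \<in> E" "j < J" "Suc (card {j'. (i, j') \<in> E \<and> j < j' \<and> j' < J}) = k"
      by (rule deep_obtain_kth[OF fin \<open>0 < k\<close> ij(2)])
    obtain i' j' where i': "(i', j) \<in> E" "i < i'" "i' \<le> I" and j': "(i, j') \<in> E" "j < j'" "j' \<le> J"
      and no: "(i', j') \<notin> E"
      by (rule biclique_free_kth[OF fin free I J])
    have "\<not> ((\<exists>J'. (i', J') \<in> E \<and> J \<le> J') \<and> (\<exists>I'. (I', j') \<in> E \<and> I \<le> I'))"
    proof
      assume "(\<exists>J'. (i', J') \<in> E \<and> J \<le> J') \<and> (\<exists>I'. (I', j') \<in> E \<and> I \<le> I')"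
      then obtain I' J' where "(I', j') \<in> E" "I \<le> I'" "(i', J') \<in> E" "J \<le> J'" by blast
      then have "(i', j') \<in> E" using closure[of I' j' i' J'] pos[OF ij(3)] i' j' by simp
      then show False using no by simp
    qed
    then consider "\<nexists>J'. (i', J') \<in> E \<and> J \<le> J'" | "\<nexists>I'. (I', j') \<in> E \<and> I \<le> I'" by blast
    then show "e \<in> T E \<union> (T (E\<inverse>))\<inverse>"
    proof cases
      case 1
      \<comment> \<open>Replacing \<open>I\<close> by the earlier row \<open>i'\<close> only shrinks
        the set of entries in between.\<close>
      have "card {x. (x, j) \<in> E \<and> i < x \<and> x < i'} \<le> card {x. (x, j) \<in> E \<and> i < x \<and> x < I}"
        using i' finite_col[OF fin] by (intro card_mono) auto
      then have "P E i j i' J" using i' J I(3) 1 by (auto simp: P_def not_le)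
      then show ?thesis using ij by (auto simp: T_def)
    next
      case 2
      have "card {x. (i, x) \<in> E \<and> j < x \<and> x < j'} \<le> card {x. (i, x) \<in> E \<and> j < x \<and> x < J}"
        using j' finite_row[OF fin] by (intro card_mono) auto
      then have "P (E\<inverse>) j i j' I" using j' I J(3) 2 by (auto simp: P_def not_le)
      then show ?thesis using ij by (auto simp: T_def)
    qed
  qed
  moreover have "T E \<subseteq> E" "T (E\<inverse>) \<subseteq> E\<inverse>" unfolding T_def by blast+
  then have "finite (T E)" "finite (T (E\<inverse>))"
    using fin by (simp_all add: finite_subset)
  ultimately have "card (deep E k) \<le> card (T E \<union> (T (E\<inverse>))\<inverse>)" by (intro card_mono) auto
  also have "\<dots> \<le> card (T E) + card (T (E\<inverse>))"
    using card_Un_le[of "T E" "(T (E\<inverse>))\<inverse>"] by simp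
  finally show ?thesis
    using card_le_deep[OF fin, of k] T T' by (simp add: algebra_simps fst_converse)
qed

section \<open>Edges within one chain\<close>

text \<open>
  The set \<open>D\<close> is the staircase of positions spanned by some edge; the join of two entries is again an
  entry unless it leaves \<open>D\<close>. A deep entry \<open>(i, j)\<close> is first charged to the \<open>k\<close>-th next row \<open>I\<close> in its
  column. A row \<open>I\<close> may receive many charges, but these essentially form an increasing chain, and
  every charge with enough successors in the chain is passed on to the row \<open>r\<close> of a close successor
  \<open>(r, s)\<close> such that \<open>(r, j)\<close> is no entry.
\<close>

locale staircase =
  fixes E :: "(real \<times> real) set" and D :: "real \<Rightarrow> real \<Rightarrow> bool" and k :: nat
  assumes fin: "finite E" and k_pos: "0 < k" and free: "biclique_free E k"
    and D_down: "\<And>i j i' j'. D i' j' \<Longrightarrow> i \<le> i' \<Longrightarrow> j \<le> j' \<Longrightarrow> D i j"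
    and E_D: "\<And>i j. (i, j) \<in> E \<Longrightarrow> D i j"
    and join: "\<And>i j i' j'. (i, j') \<in> E \<Longrightarrow> (i', j) \<in> E \<Longrightarrow> i < i' \<Longrightarrow> j < j' \<Longrightarrow> D i' j' \<Longrightarrow> (i', j') \<in> E"
begin

text \<open>\<open>I\<close> is the \<open>k\<close>-th next row in the column of \<open>e\<close>.
  The last clause replaces an explicit end of row \<open>I\<close>: fewer than \<open>k\<close> of
  the later entries in the row of \<open>e\<close> sit over columns at which row \<open>I\<close> is
  still inside \<open>D\<close>.\<close>

definition top_row :: "real \<times> real \<Rightarrow> real \<Rightarrow> bool" where
  "top_row e I \<longleftrightarrow> (I, snd e) \<in> E \<and> fst e < I
     \<and> Suc (card {i'. (i', snd e) \<in> E \<and> fst e < i' \<and> i' < I}) = k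
     \<and> card {j'. (fst e, j') \<in> E \<and> snd e < j' \<and> D I j'} < k"

text \<open>By \<open>join\<close>, the missing corner \<open>(i', j')\<close> must lie outside
  \<open>D\<close>, and then so does \<open>(I, J)\<close>. Hence the later entries over columns
  where row \<open>I\<close> is inside \<open>D\<close> all come before \<open>J\<close>.\<close>

lemma deep_top_row:
  assumes "e \<in> deep E k"
  shows "\<exists>I. top_row e I"
proof -
  obtain i j where ij: "e = (i, j)" "(i, j) \<in> deep E k" using assms by (cases e) auto
  obtain I J where I: "(I, j) \<in> E" "i < I" "Suc (card {i'. (i', j) \<in> E \<and> i < i' \<and> i' < I}) = k"
    and J: "(i, J) \<in> E" "j < J" "Suc (card {j'. (i, j') \<in> E \<and> j < j' \<and> j' < J}) = k"
    by (rule deep_obtain_kth[OF fin k_pos ij(2)])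
  obtain i' j' where i': "(i', j) \<in> E" "i < i'" "i' \<le> I" and j': "(i, j') \<in> E" "j < j'" "j' \<le> J"
    and no: "(i', j') \<notin> E"
    by (rule biclique_free_kth[OF fin free I J])
  have nD: "\<not> D I J" using join[OF j'(1) i'(1) i'(2) j'(2)] D_down[of I J i' j'] i' j' no by blast
  have "{j'. (i, j') \<in> E \<and> j < j' \<and> D I j'} \<subseteq> {j'. (i, j') \<in> E \<and> j < j' \<and> j' < J}"
    using nD D_down[of I _ I J] by (auto simp: not_less[symmetric])
  then have "card {j'. (i, j') \<in> E \<and> j < j' \<and> D I j'} \<le> card {j'. (i, j') \<in> E \<and> j < j' \<and> j' < J}"
    using finite_row[OF fin] by (intro card_mono) auto
  then show ?thesis using I J(3) ij by (auto simp: top_row_def)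
qed

definition target :: "real \<times> real \<Rightarrow> real" where
  "target e = (SOME I. top_row e I)"

lemma top_row_target: "e \<in> deep E k \<Longrightarrow> top_row e (target e)"
  using deep_top_row someI_ex[of "top_row e"] by (auto simp: target_def)

definition charged :: "real \<Rightarrow> (real \<times> real) set" where
  "charged I = {e \<in> deep E k. target e = I}"

lemma deep_E: "deep E k \<subseteq> E"
  by (auto simp: deep_def)

lemma finite_deep: "finite (deep E k)"
  using deep_E fin finite_subset by blast

lemma finite_charged: "finite (charged I)"
  using finite_deep by (simp add: charged_def)

lemma charged_D:
  assumes "(i, j) \<in> charged I"
  shows "(i, j) \<in> E" "(I, j) \<in> E" "i < I" "D I j"
    "Suc (card {i'. (i', j) \<in> E \<and> i < i' \<and> i' < I}) = k"
    "card {j'. (i, j') \<in> E \<and> j < j' \<and> D I j'} < k"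
  using assms top_row_target[of "(i, j)"] deep_E E_D[of I j] by (auto simp: charged_def top_row_def)

text \<open>Two charges to \<open>I\<close> in the same column have the same number of entries
  between themselves and \<open>I\<close>, so they coincide.\<close>

lemma inj_charged: "inj_on snd (charged I)"
proof -
  have False if a: "(i, j) \<in> charged I" and b: "(i', j) \<in> charged I" and "i < i'" for i i' j
  proof -
    have "{x. (x, j) \<in> E \<and> i' < x \<and> x < I} \<subset> {x. (x, j) \<in> E \<and> i < x \<and> x < I}"
      using charged_D[OF b] \<open>i < i'\<close> by force
    then have "card {x. (x, j) \<in> E \<and> i' < x \<and> x < I} < card {x. (x, j) \<in> E \<and> i < x \<and> x < I}"
      using finite_col[OF fin] by (intro psubset_card_mono) auto
    then show False using charged_D(5)[OF a] charged_D(5)[OF b] by simp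
  qed
  then show ?thesis by (auto simp: inj_on_def) (metis linorder_neqE)
qed

text \<open>A charge in row \<open>r\<close> is one of the last \<open>k\<close> entries of that row
  over columns at which row \<open>I\<close> is inside \<open>D\<close>.\<close>

lemma card_charged_row: "card {s. (r, s) \<in> charged I} \<le> k"
proof -
  let ?S = "{s. (r, s) \<in> E \<and> D I s}"
  have "{s. (r, s) \<in> charged I} \<subseteq> {s \<in> ?S. card {s' \<in> ?S. s < s'} < k}"
  proof
    fix s assume "s \<in> {s. (r, s) \<in> charged I}"
    then have s: "(r, s) \<in> charged I" by simp
    have "{s' \<in> ?S. s < s'} = {s'. (r, s') \<in> E \<and> s < s' \<and> D I s'}" by auto
    then show "s \<in> {s \<in> ?S. card {s' \<in> ?S. s < s'} < k}" using charged_D[OF s] by simp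
  qed
  then have "card {s. (r, s) \<in> charged I} \<le> card {s \<in> ?S. card {s' \<in> ?S. s < s'} < k}"
    using finite_row[OF fin] by (intro card_mono) auto
  also have "\<dots> \<le> k" using card_few_above_le[of ?S "\<lambda>x. x" k] finite_row[OF fin] by simp
  finally show ?thesis .
qed

text \<open>A good successor \<open>b\<close> of \<open>c\<close> in the chain of charges to
  \<open>I\<close> lies strictly beyond \<open>c\<close> in both coordinates, and the corner formed
  by its row and the column of \<open>c\<close> is missing. The missing corner is what limits the
  charges passed on to the row of \<open>b\<close>.\<close>

definition good :: "real \<Rightarrow> real \<times> real \<Rightarrow> real \<times> real \<Rightarrow> bool" where
  "good I c b \<longleftrightarrow> b \<in> charged I \<and> snd c < snd b \<and> fst c < fst b \<and> (fst b, snd c) \<notin> E"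

text \<open>A later charge fails to be good in two ways. If its row is at most \<open>i\<close>,
  then \<open>join\<close> puts its column into row \<open>i\<close>, inside \<open>D\<close> at row
  \<open>I\<close>, which \<open>top_row\<close> allows fewer than \<open>k\<close> times. Otherwise
  its row is an entry of column \<open>j\<close> between \<open>i\<close> and \<open>I\<close>;
  there are fewer than \<open>k\<close> such rows, with at most \<open>k\<close> charges
  each.\<close>

lemma card_not_good:
  assumes c: "(i, j) \<in> charged I"
  shows "card {b \<in> charged I. j < snd b \<and> \<not> good I (i, j) b} < k + k * k"
proof -
  let ?B1 = "{b \<in> charged I. j < snd b \<and> fst b \<le> i}"
  let ?B2 = "{b \<in> charged I. i < fst b \<and> (fst b, j) \<in> E}"
  have "card ?B1 \<le> card {j'. (i, j') \<in> E \<and> j < j' \<and> D I j'}"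
  proof (rule card_inj_on_le[of snd])
    show "inj_on snd ?B1" using inj_charged by (rule inj_on_subset) auto
    show "snd ` ?B1 \<subseteq> {j'. (i, j') \<in> E \<and> j < j' \<and> D I j'}"
    proof clarsimp
      fix r s assume b: "(r, s) \<in> charged I" "j < s" "r \<le> i"
      have "D i s" using charged_D[OF c] charged_D[OF b(1)] D_down[of I s i s] by simp
      then have "(i, s) \<in> E"
        using join[of r s i j] charged_D[OF c] charged_D[OF b(1)] b by (cases "r = i") auto
      then show "(i, s) \<in> E \<and> D I s" using charged_D[OF b(1)] by simp
    qed
  qed (rule finite_row[OF fin])
  then have 1: "card ?B1 < k" using charged_D[OF c] by simp
  have "card ?B2 \<le> k * card {i'. (i', j) \<in> E \<and> i < i' \<and> i' < I}"
  proof (rule card_le_mult_of_fibers[where f = fst])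
    fix r
    have "{e \<in> ?B2. fst e = r} \<subseteq> Pair r ` {s. (r, s) \<in> charged I}" by auto
    moreover have "finite {s. (r, s) \<in> charged I}"
      by (rule finite_subset[OF _ finite_imageI[OF finite_charged[of I], of snd]]) force
    ultimately have "card {e \<in> ?B2. fst e = r} \<le> card {s. (r, s) \<in> charged I}"
      by (intro surj_card_le)
    then show "card {e \<in> ?B2. fst e = r} \<le> k" using card_charged_row le_trans by blast
  next
    show "fst e \<in> {i'. (i', j) \<in> E \<and> i < i' \<and> i' < I}" if "e \<in> ?B2" for e
      using that charged_D(3)[of "fst e" "snd e" I] by simp
  qed (use finite_col[OF fin] finite_charged in auto)
  also have "\<dots> \<le> k * k" using charged_D(5)[OF c] by (intro mult_le_mono2) simp
  finally have 2: "card ?B2 \<le> k * k" .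
  have "card {b \<in> charged I. j < snd b \<and> \<not> good I (i, j) b} \<le> card (?B1 \<union> ?B2)"
    using finite_charged by (intro card_mono) (auto simp: good_def)
  also have "\<dots> \<le> card ?B1 + card ?B2" by (rule card_Un_le)
  finally show ?thesis using 1 2 by simp
qed

definition next_good :: "real \<times> real \<Rightarrow> real \<times> real \<Rightarrow> bool" where
  "next_good c b \<longleftrightarrow> good (target c) c b
     \<and> card {b' \<in> charged (target c). snd c < snd b' \<and> snd b' < snd b} < k + k * k"

text \<open>Among many later charges some are good. The one with the least column works, since every
  charge before it is not good and there are few of these.\<close>

lemma ex_next_good:
  assumes c: "c \<in> deep E k" and many: "k + k * k \<le> card {b \<in> charged (target c). snd c < snd b}"
  shows "\<exists>b. next_good c b"
proof -
  have cc: "(fst c, snd c) \<in> charged (target c)" using c by (simp add: charged_def)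
  let ?G = "{b \<in> charged (target c). good (target c) c b}"
  have "?G \<noteq> {}"
  proof
    assume "?G = {}"
    then have "{b \<in> charged (target c). snd c < snd b}
        = {b \<in> charged (target c). snd c < snd b \<and> \<not> good (target c) c b}" by auto
    then show False using card_not_good[OF cc] many by simp
  qed
  moreover have "finite ?G" using finite_charged by simp
  ultimately obtain b where b: "b \<in> ?G" "\<And>b'. b' \<in> ?G \<Longrightarrow> snd b \<le> snd b'"
    using ex_is_arg_min_if_finite[of ?G snd] by (auto simp: is_arg_min_linorder)
  have "{b' \<in> charged (target c). snd c < snd b' \<and> snd b' < snd b}
      \<subseteq> {b' \<in> charged (target c). snd c < snd b' \<and> \<not> good (target c) c b'}"
    using b(2) by force
  then have "card {b' \<in> charged (target c). snd c < snd b' \<and> snd b' < snd b}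
      \<le> card {b' \<in> charged (target c). snd c < snd b' \<and> \<not> good (target c) c b'}"
    using finite_charged by (intro card_mono) auto
  then have "next_good c b" using card_not_good[OF cc] b(1) by (simp add: next_good_def)
  then show ?thesis ..
qed

lemma card_sparse_charged:
  "card {c \<in> deep E k. card {b \<in> charged (target c). snd c < snd b} < m} \<le> m * card (fst ` E)"
proof (rule card_le_mult_of_fibers[where f = target])
  fix I
  have "{e \<in> {c \<in> deep E k. card {b \<in> charged (target c). snd c < snd b} < m}. target e = I}
     = {c \<in> charged I. card {b \<in> charged I. snd c < snd b} < m}" by (auto simp: charged_def)
  then show "card {e \<in> {c \<in> deep E k. card {b \<in> charged (target c). snd c < snd b} < m}. target e = I} \<le> m"
    using card_few_above_le[OF finite_charged inj_charged] by simp
qed (use finite_deep fin top_row_target in \<open>force simp: top_row_def\<close>)+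

text \<open>Such a \<open>c\<close> is charged to the same row as \<open>b\<close> and is one of the
  last \<open>k + k * k\<close> charges before \<open>b\<close>.\<close>

lemma card_before_good:
  "card {c \<in> deep E k. next_good c b} \<le> k + k * k"
proof -
  let ?S = "{c \<in> charged (target b). snd c < snd b}"
  have "{c \<in> deep E k. next_good c b} \<subseteq> {c \<in> ?S. card {b' \<in> ?S. snd c < snd b'} < k + k * k}"
  proof
    fix c assume c: "c \<in> {c \<in> deep E k. next_good c b}"
    then have "target b = target c" "c \<in> ?S" by (auto simp: next_good_def good_def charged_def)
    moreover from this have
      "{b' \<in> ?S. snd c < snd b'} = {b' \<in> charged (target c). snd c < snd b' \<and> snd b' < snd b}" by auto
    ultimately show "c \<in> {c \<in> ?S. card {b' \<in> ?S. snd c < snd b'} < k + k * k}"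
      using c by (auto simp: next_good_def)
  qed
  then have "card {c \<in> deep E k. next_good c b}
      \<le> card {c \<in> ?S. card {b' \<in> ?S. snd c < snd b'} < k + k * k}"
    using finite_charged by (intro card_mono) auto
  also have "\<dots> \<le> k + k * k"
    using finite_charged inj_on_subset[OF inj_charged, of ?S "target b"]
    by (intro card_few_above_le) auto
  finally show ?thesis .
qed

text \<open>Compare every column \<open>s\<close> with the least one, \<open>s0\<close>, through the
  rows \<open>I\<close> and \<open>I0\<close> to which \<open>(r, s)\<close> and
  \<open>(r, s0)\<close> are charged. If \<open>I0 \<le> I\<close>, then row \<open>I0\<close> is
  inside \<open>D\<close> at \<open>s\<close>, which happens for fewer than \<open>k\<close>
  columns. If \<open>I < I0\<close>, then \<open>(I, s0)\<close> turns out to be an entry between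
  \<open>r\<close> and \<open>I0\<close>. This leaves fewer than \<open>k\<close> rows
  \<open>I\<close>, each with at most \<open>k\<close> charges in row \<open>r\<close>.\<close>

lemma card_targets:
  "card {s. \<exists>c\<in>deep E k. next_good c (r, s)} \<le> k + k * k"
proof (cases "{s. \<exists>c\<in>deep E k. next_good c (r, s)} = {}")
  case False
  let ?Z = "{s. \<exists>c\<in>deep E k. next_good c (r, s)}"
  have Z: "(r, s) \<in> charged (target (r, s)) \<and> (r, s) \<in> deep E k" if "s \<in> ?Z" for s
    using that by (auto simp: next_good_def good_def charged_def)
  have finZ: "finite ?Z"
    by (rule finite_subset[OF _ finite_imageI[OF finite_deep, of snd]]) (use Z in force)
  define s0 where "s0 = Min ?Z"
  have s0: "s0 \<in> ?Z" "\<And>s. s \<in> ?Z \<Longrightarrow> s0 \<le> s"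
    using finZ False Min_in[of ?Z] unfolding s0_def by (simp_all del: mem_Collect_eq)
  define I0 where "I0 = target (r, s0)"
  have c0: "(r, s0) \<in> charged I0" using Z[OF s0(1)] I0_def by simp
  let ?Y1 = "{s. (r, s) \<in> E \<and> s0 < s \<and> D I0 s}"
  let ?Y2 = "{s \<in> ?Z. target (r, s) \<in> {i'. (i', s0) \<in> E \<and> r < i' \<and> i' < I0}}"
  have "?Z \<subseteq> insert s0 (?Y1 \<union> ?Y2)"
  proof
    fix s assume s: "s \<in> ?Z"
    show "s \<in> insert s0 (?Y1 \<union> ?Y2)"
    proof (cases "s = s0")
      case False
      then have lt: "s0 < s" using s0(2)[OF s] by simp
      define I where "I = target (r, s)"
      have b: "(r, s) \<in> charged I" using Z[OF s] I_def by simp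
      obtain i j where c: "(i, j) \<in> deep E k" "next_good (i, j) (r, s)" using s by auto
      have "target (i, j) = I" using c by (auto simp: next_good_def good_def charged_def I_def)
      then have c': "(i, j) \<in> charged I" "j < s" "i < r" "(r, j) \<notin> E"
        using c by (auto simp: next_good_def good_def charged_def)
      show ?thesis
      proof (cases "I0 \<le> I")
        case True
        then have "D I0 s" using D_down charged_D(4)[OF b] by blast
        then show ?thesis using charged_D(1)[OF b] lt by simp
      next
        case False
        \<comment> \<open>Otherwise \<open>join\<close> applied to \<open>(i, j)\<close> and
          \<open>(r, s0)\<close> would supply the corner \<open>(r, j)\<close>, which is missing
          because \<open>(r, s)\<close> is good for \<open>(i, j)\<close>.\<close>
        have "j < s0"
        proof (rule ccontr)
          assume "\<not> j < s0"
          moreover have "j \<noteq> s0" using c'(4) charged_D(1)[OF c0] by auto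
          ultimately have "s0 < j" by simp
          moreover have "D r j" using E_D[OF charged_D(1)[OF b]] D_down c'(2) by (meson less_imp_le order_refl)
          ultimately have "(r, j) \<in> E"
            using join[OF charged_D(1)[OF c'(1)] charged_D(1)[OF c0] c'(3)] by simp
          then show False using c'(4) by simp
        qed
        moreover have "D I s0" using charged_D(4)[OF b] D_down lt by (meson less_imp_le order_refl)
        ultimately have "(I, s0) \<in> E"
          using join[OF charged_D(1)[OF c0] charged_D(2)[OF c'(1)] charged_D(3)[OF b]] by simp
        then show ?thesis using s False charged_D(3)[OF b] by (auto simp: I_def)
      qed
    qed simp
  qed
  then have "card ?Z \<le> card (insert s0 (?Y1 \<union> ?Y2))"
    using finZ finite_row[OF fin] by (intro card_mono) auto
  also have "\<dots> \<le> Suc (card (?Y1 \<union> ?Y2))" by (rule card_insert_le_m1) auto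
  also have "\<dots> \<le> Suc (card ?Y1 + card ?Y2)" using card_Un_le[of ?Y1 ?Y2] by simp
  finally have le: "card ?Z \<le> Suc (card ?Y1 + card ?Y2)" .
  have "card ?Y2 \<le> k * card {i'. (i', s0) \<in> E \<and> r < i' \<and> i' < I0}"
  proof (rule card_le_mult_of_fibers[where f = "\<lambda>s. target (r, s)"])
    fix I
    have "{e \<in> ?Y2. target (r, e) = I} \<subseteq> {s. (r, s) \<in> charged I}" using Z by auto
    moreover have "finite {s. (r, s) \<in> charged I}"
      by (rule finite_subset[OF _ finite_imageI[OF finite_charged[of I], of snd]]) force
    ultimately have "card {e \<in> ?Y2. target (r, e) = I} \<le> card {s. (r, s) \<in> charged I}"
      by (intro card_mono)
    then show "card {e \<in> ?Y2. target (r, e) = I} \<le> k" using card_charged_row le_trans by blast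
  qed (use finZ finite_col[OF fin] in auto)
  also have "\<dots> \<le> k * k" using charged_D(5)[OF c0] by (intro mult_le_mono2) simp
  finally show ?thesis using le charged_D(6)[OF c0] by simp
next
  case True
  show ?thesis unfolding True by simp
qed

text \<open>Each such entry is sent to a chosen good successor and then to the row of that
  successor. Both maps have fibers of size at most \<open>k + k * k\<close>.\<close>

lemma card_dense_charged:
  "card {c \<in> deep E k. \<exists>b. next_good c b} \<le> (k + k * k) * (k + k * k) * card (fst ` E)"
proof -
  define \<beta> where "\<beta> c = (SOME b. next_good c b)" for c
  let ?X = "{c \<in> deep E k. \<exists>b. next_good c b}"
  have \<beta>: "next_good c (\<beta> c)" if "c \<in> ?X" for c
    using that someI_ex[of "next_good c"] by (auto simp: \<beta>_def)
  have finX: "finite ?X" using finite_deep by simp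
  have "card ?X \<le> (k + k * k) * card (\<beta> ` ?X)"
  proof (rule card_le_mult_of_fibers[where f = \<beta>])
    fix b
    have "card {e \<in> ?X. \<beta> e = b} \<le> card {c \<in> deep E k. next_good c b}"
      using finite_deep \<beta> by (intro card_mono) auto
    then show "card {e \<in> ?X. \<beta> e = b} \<le> k + k * k" using card_before_good le_trans by blast
  qed (use finX in auto)
  also have "card (\<beta> ` ?X) \<le> (k + k * k) * card (fst ` E)"
  proof (rule card_le_mult_of_fibers[where f = fst])
    fix r
    have sub: "{s. \<exists>c\<in>deep E k. next_good c (r, s)} \<subseteq> snd ` deep E k"
      by (force simp: next_good_def good_def charged_def)
    have "{b \<in> \<beta> ` ?X. fst b = r} \<subseteq> Pair r ` {s. \<exists>c\<in>deep E k. next_good c (r, s)}"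
    proof
      fix b assume "b \<in> {b \<in> \<beta> ` ?X. fst b = r}"
      then obtain c where c: "c \<in> ?X" "b = \<beta> c" "fst b = r" by auto
      then have "b = (r, snd b)" by auto
      then show "b \<in> Pair r ` {s. \<exists>c\<in>deep E k. next_good c (r, s)}"
        using \<beta>[OF c(1)] c by (metis (mono_tags, lifting) image_eqI mem_Collect_eq)
    qed
    then have "card {b \<in> \<beta> ` ?X. fst b = r} \<le> card {s. \<exists>c\<in>deep E k. next_good c (r, s)}"
      using finite_subset[OF sub] finite_deep by (intro surj_card_le) auto
    then show "card {b \<in> \<beta> ` ?X. fst b = r} \<le> k + k * k" using card_targets le_trans by blast
  next
    fix b assume "b \<in> \<beta> ` ?X"
    then obtain c where "next_good c b" using \<beta> by blast
    then have "b \<in> E" using deep_E by (auto simp: next_good_def good_def charged_def)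
    then show "fst b \<in> fst ` E" by simp
  qed (use finX fin in auto)
  finally show ?thesis by (simp add: mult.assoc)
qed

text \<open>A deep entry either is among the last \<open>k + k * k\<close> charges to its row or has
  a close good successor; the remaining summand \<open>k\<close> pays for the entries that are not
  deep.\<close>

lemma card_staircase:
  "card E \<le> (2 * k + k * k + (k + k * k) * (k + k * k)) * (card (fst ` E) + card (snd ` E))"
proof -
  let ?m = "k + k * k"
  let ?A = "{c \<in> deep E k. card {b \<in> charged (target c). snd c < snd b} < ?m}"
  let ?B = "{c \<in> deep E k. \<exists>b. next_good c b}"
  have "deep E k \<subseteq> ?A \<union> ?B" using ex_next_good not_less by blast
  then have "card (deep E k) \<le> card (?A \<union> ?B)"
    using finite_deep by (intro card_mono) auto
  also have "\<dots> \<le> card ?A + card ?B" by (rule card_Un_le)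
  also have "\<dots> \<le> ?m * card (fst ` E) + ?m * ?m * card (fst ` E)"
    using card_sparse_charged card_dense_charged by (intro add_mono)
  also have "\<dots> = (?m + ?m * ?m) * card (fst ` E)" by (simp add: algebra_simps)
  also have "\<dots> \<le> (?m + ?m * ?m) * (card (fst ` E) + card (snd ` E))" by (intro mult_le_mono2) simp
  finally have "card E \<le> k * (card (fst ` E) + card (snd ` E))
      + (?m + ?m * ?m) * (card (fst ` E) + card (snd ` E))"
    using card_le_deep[OF fin, of k] by simp
  also have "\<dots> = (k + (?m + ?m * ?m)) * (card (fst ` E) + card (snd ` E))"
    by (simp only: distrib_right)
  also have "k + (?m + ?m * ?m) = 2 * k + k * k + ?m * ?m" by simp
  finally show ?thesis .
qed

end

section \<open>Splitting one chain into blocks\<close>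

lemma biclique_free_subset: "biclique_free E k \<Longrightarrow> F \<subseteq> E \<Longrightarrow> biclique_free F k"
  unfolding biclique_free_def by blast

lemma sum_card_fibers_le:
  assumes "finite M" "finite X"
  shows "(\<Sum>m\<in>M. card {x \<in> X. f x = m}) \<le> card X"
proof -
  have "(\<Sum>m\<in>M. card {x \<in> X. f x = m}) = card (\<Union>m\<in>M. {x \<in> X. f x = m})"
    using assms by (intro card_UN_disjoint[symmetric]) auto
  also have "\<dots> \<le> card X" using assms by (intro card_mono) auto
  finally show ?thesis .
qed

text \<open>
  The witness maps \<open>x\<close> to the maximal number of points up to \<open>x\<close> that are pairwise not covered.
\<close>

lemma ex_block_index:
  fixes X :: "real set"
  assumes fin: "finite X"
    and down: "\<And>p q p' q'. cov p' q' \<Longrightarrow> p' \<le> p \<Longrightarrow> q \<le> q' \<Longrightarrow> cov p q"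
  shows "\<exists>c :: real \<Rightarrow> nat. mono c
    \<and> (\<forall>p\<in>X. \<forall>q\<in>X. cov p q \<longrightarrow> c q \<le> Suc (c p))
    \<and> (\<forall>p\<in>X. \<forall>q\<in>X. p < q \<longrightarrow> c p = c q \<longrightarrow> cov p q)"
proof -
  define indep where "indep x = {S. S \<subseteq> X \<and> (\<forall>s\<in>S. s \<le> x) \<and> (\<forall>s\<in>S. \<forall>s'\<in>S. s < s' \<longrightarrow> \<not> cov s s')}" for x
  define c where "c x = Max (card ` indep x)" for x
  have fini: "finite (indep x)" for x
    by (rule finite_subset[of _ "Pow X"]) (use fin in \<open>auto simp: indep_def\<close>)
  have "{} \<in> indep x" for x by (simp add: indep_def)
  then have ne: "card ` indep x \<noteq> {}" for x by blast
  have c_ge: "card S \<le> c x" if "S \<in> indep x" for S x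
    using that fini by (simp add: c_def)
  have c_ex: "\<exists>S\<in>indep x. card S = c x" for x
    using Max_in[OF _ ne[of x]] fini[of x] by (auto simp: c_def)
  have finS: "finite S" if "S \<in> indep x" for S x
    using that fin finite_subset by (auto simp: indep_def)
  show ?thesis
  proof (intro exI[of _ c] conjI monoI ballI impI)
    fix p q :: real assume "p \<le> q"
    then have "indep p \<subseteq> indep q" by (force simp: indep_def)
    then show "c p \<le> c q" using c_ex[of p] c_ge[of _ q] by force
  next
    fix p q assume pq: "p \<in> X" "q \<in> X" "cov p q"
    obtain S where S: "S \<in> indep q" "card S = c q" using c_ex by blast
    \<comment> \<open>Two elements of \<open>S\<close> beyond \<open>p\<close> would both lie below
      \<open>q\<close>, or at it, and would be covered because \<open>p\<close> and \<open>q\<close>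
      are.\<close>
    have "card {s \<in> S. p < s} \<le> 1"
    proof -
      have "s = s'" if "s \<in> S" "s' \<in> S" "p < s" "p < s'" for s s'
      proof -
        have "s \<le> q" "s' \<le> q" using S that by (auto simp: indep_def)
        then have "cov s s'" "cov s' s" using down[OF pq(3)] that by auto
        then show ?thesis using S(1) that by (auto simp: indep_def) (metis linorder_neqE)
      qed
      then show ?thesis using finS[OF S(1)] by (auto simp: card_le_Suc0_iff_eq)
    qed
    moreover have "card {s \<in> S. s \<le> p} \<le> c p"
      using S(1) by (intro c_ge) (auto simp: indep_def)
    moreover have "card S \<le> card {s \<in> S. s \<le> p} + card {s \<in> S. p < s}"
    proof -
      have "S = {s \<in> S. s \<le> p} \<union> {s \<in> S. p < s}" by auto
      then show ?thesis using card_Un_le by metis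
    qed
    ultimately show "c q \<le> Suc (c p)" using S(2) by simp
  next
    fix p q assume pq: "p \<in> X" "q \<in> X" "p < q" "c p = c q"
    show "cov p q"
    proof (rule ccontr)
      assume no: "\<not> cov p q"
      obtain S where S: "S \<in> indep p" "card S = c p" using c_ex by blast
      have "\<not> cov s q" if "s \<in> S" for s
        using no down[of s q p q] S(1) that by (auto simp: indep_def)
      moreover have "s < q" if "s \<in> S" for s using S(1) that pq by (force simp: indep_def)
      \<comment> \<open>If \<open>q\<close> is not covered from \<open>p\<close>, it is not covered
        from any earlier point, so it enlarges an optimal set for \<open>p\<close>.\<close>
      ultimately have "insert q S \<in> indep q" using S(1) pq
        by (auto simp: indep_def dest: less_imp_le order.asym)
      moreover have "q \<notin> S" using \<open>\<And>s. s \<in> S \<Longrightarrow> s < q\<close> by blast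
      ultimately have "Suc (c p) \<le> c q" using c_ge[of "insert q S" q] S finS[OF S(1)] by simp
      then show False using pq by simp
    qed
  qed
qed

text \<open>Here the join of two entries whose lower corner is an entry is always an entry, so no
  corner can be missing and no entry is deep. This is the situation inside one block.\<close>

lemma card_biclique_free_covered:
  fixes E :: "(real \<times> real) set"
  assumes fin: "finite E" and "0 < k" and free: "biclique_free E k"
    and join: "\<And>i j i' j'. (i, j) \<in> E \<Longrightarrow> (i, j') \<in> E \<Longrightarrow> (i', j) \<in> E \<Longrightarrow> i < i' \<Longrightarrow> j < j'
      \<Longrightarrow> (i', j') \<in> E"
  shows "card E \<le> k * (card (fst ` E) + card (snd ` E))"
proof -
  have "deep E k = {}"
  proof (rule ccontr)
    assume "deep E k \<noteq> {}"
    then obtain i j where ij: "(i, j) \<in> deep E k" by auto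
    obtain I J where I: "(I, j) \<in> E" "i < I" "Suc (card {i'. (i', j) \<in> E \<and> i < i' \<and> i' < I}) = k"
      and J: "(i, J) \<in> E" "j < J" "Suc (card {j'. (i, j') \<in> E \<and> j < j' \<and> j' < J}) = k"
      by (rule deep_obtain_kth[OF fin \<open>0 < k\<close> ij])
    obtain i' j' where "(i', j) \<in> E" "i < i'" "(i, j') \<in> E" "j < j'" "(i', j') \<notin> E"
      by (rule biclique_free_kth[OF fin free I J])
    moreover have "(i, j) \<in> E" using ij by (auto simp: deep_def)
    ultimately show False using join by blast
  qed
  then show ?thesis using card_le_deep[OF fin, of k] by simp
qed

text \<open>\<open>c\<close> numbers the blocks. \<open>E0\<close> collects the edges inside a
  block, where every pair is spanned, and \<open>F m\<close> those from block \<open>m\<close> to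
  the next one, where all left ends precede all right ends and \<open>staircase\<close>
  applies.\<close>

lemma card_biclique_free_terrain:
  fixes E :: "(real \<times> real) set"
  assumes finX: "finite X" and "0 < k" and free: "biclique_free E k"
    and EX: "\<And>i j. (i, j) \<in> E \<Longrightarrow> - i \<in> X \<and> j \<in> X \<and> - i < j"
    and join: "\<And>i j i' j' I J. (i, j') \<in> E \<Longrightarrow> (i', j) \<in> E \<Longrightarrow> i < i' \<Longrightarrow> j < j' \<Longrightarrow> - i < j
      \<Longrightarrow> (I, J) \<in> E \<Longrightarrow> i' \<le> I \<Longrightarrow> j' \<le> J \<Longrightarrow> (i', j') \<in> E"
  shows "card E \<le> (2 * k + 2 * (2 * k + k * k + (k + k * k) * (k + k * k))) * card X"
proof -
  let ?C = "2 * k + k * k + (k + k * k) * (k + k * k)"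
  define cov where "cov p q \<longleftrightarrow> (\<exists>(I, J)\<in>E. - I \<le> p \<and> q \<le> J)" for p q
  have cov_down: "cov p q" if "cov p' q'" "p' \<le> p" "q \<le> q'" for p q p' q'
  proof -
    from that(1) obtain I J where "(I, J) \<in> E" "- I \<le> p'" "q' \<le> J" by (auto simp: cov_def)
    then have "(I, J) \<in> E" "- I \<le> p" "q \<le> J" using that by auto
    then show ?thesis unfolding cov_def by blast
  qed
  have "\<exists>c :: real \<Rightarrow> nat. mono c
    \<and> (\<forall>p\<in>X. \<forall>q\<in>X. cov p q \<longrightarrow> c q \<le> Suc (c p))
    \<and> (\<forall>p\<in>X. \<forall>q\<in>X. p < q \<longrightarrow> c p = c q \<longrightarrow> cov p q)"
    by (rule ex_block_index[OF finX]) (rule cov_down)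
  then obtain c :: "real \<Rightarrow> nat" where mono: "\<And>p q. p \<le> q \<Longrightarrow> c p \<le> c q"
    and c1: "\<And>p q. p \<in> X \<Longrightarrow> q \<in> X \<Longrightarrow> cov p q \<Longrightarrow> c q \<le> Suc (c p)"
    and c2: "\<And>p q. p \<in> X \<Longrightarrow> q \<in> X \<Longrightarrow> p < q \<Longrightarrow> c p = c q \<Longrightarrow> cov p q"
    unfolding mono_def by blast
  have join': "(i', j') \<in> E"
    if "(i, j') \<in> E" "(i', j) \<in> E" "i < i'" "j < j'" "- i < j" "cov (- i') j'" for i j i' j'
    using that join[of i j' i' j] by (auto simp: cov_def)
  have fin: "finite E"
  proof (rule finite_subset)
    show "E \<subseteq> (uminus ` X) \<times> X"
    proof clarify
      fix i j assume "(i, j) \<in> E"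
      then have "- i \<in> X" "j \<in> X" using EX by auto
      moreover have "i = - (- i)" by simp
      ultimately show "i \<in> uminus ` X \<and> j \<in> X" by blast
    qed
  qed (use finX in simp)
  define E0 where "E0 = {(i, j) \<in> E. c (- i) = c j}"
  define F where "F m = {(i, j) \<in> E. c (- i) = m \<and> c j = Suc m}" for m
  define Xm where "Xm m = {x \<in> X. c x = m}" for m
  have rows: "card (fst ` A) \<le> card {x \<in> X. P x}" if "A \<subseteq> E" "\<And>i j. (i, j) \<in> A \<Longrightarrow> P (- i)" for A P
  proof -
    have "fst ` A \<subseteq> uminus ` {x \<in> X. P x}"
    proof
      fix i assume "i \<in> fst ` A"
      then have "- i \<in> {x \<in> X. P x}" using that EX by force
      moreover have "i = - (- i)" by simp
      ultimately show "i \<in> uminus ` {x \<in> X. P x}" by blast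
    qed
    then show ?thesis using finX by (intro surj_card_le) auto
  qed
  have cols: "card (snd ` A) \<le> card {x \<in> X. P x}" if "A \<subseteq> E" "\<And>i j. (i, j) \<in> A \<Longrightarrow> P j" for A P
    using that EX finX by (intro card_mono) fastforce+
  have "card E0 \<le> k * (card (fst ` E0) + card (snd ` E0))"
  proof (rule card_biclique_free_covered)
    show "finite E0" by (rule finite_subset[OF _ fin]) (auto simp: E0_def)
    show "biclique_free E0 k" by (rule biclique_free_subset[OF free]) (auto simp: E0_def)
    fix i j i' j' assume a: "(i, j) \<in> E0" "(i, j') \<in> E0" "(i', j) \<in> E0" "i < i'" "j < j'"
    then have e: "(i, j) \<in> E" "(i, j') \<in> E" "(i', j) \<in> E" and eq: "c (- i') = c j'"
      by (auto simp: E0_def)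
    have "cov (- i') j'"
      using EX[OF e(1)] EX[OF e(2)] EX[OF e(3)] a eq by (intro c2) auto
    then have "(i', j') \<in> E" using join'[of i j' i' j] e a EX[OF e(1)] by auto
    then show "(i', j') \<in> E0" using eq by (simp add: E0_def)
  qed fact
  also have "\<dots> \<le> k * (card X + card X)"
  proof (intro mult_le_mono2 add_mono)
    have "E0 \<subseteq> E" by (auto simp: E0_def)
    then show "card (fst ` E0) \<le> card X" "card (snd ` E0) \<le> card X"
      using rows[of E0 "\<lambda>_. True"] cols[of E0 "\<lambda>_. True"] by simp_all
  qed
  finally have E0: "card E0 \<le> 2 * k * card X" by (simp add: algebra_simps)
  have F: "card (F m) \<le> ?C * (card (Xm m) + card (Xm (Suc m)))" for m
  proof -
    interpret staircase "F m" "\<lambda>i j. cov (- i) j" k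
    proof
      show "finite (F m)" by (rule finite_subset[OF _ fin]) (auto simp: F_def)
      show "biclique_free (F m) k" by (rule biclique_free_subset[OF free]) (auto simp: F_def)
      show "cov (- i) j" if "cov (- i') j'" "i \<le> i'" "j \<le> j'" for i j i' j'
        using cov_down[OF that(1), of "- i" j] that by simp
      show "cov (- i) j" if "(i, j) \<in> F m" for i j using that by (auto simp: cov_def F_def)
      fix i j i' j' assume a: "(i, j') \<in> F m" "(i', j) \<in> F m" "i < i'" "j < j'" "cov (- i') j'"
      \<comment> \<open>\<open>- i\<close> is in block \<open>m\<close> and \<open>j\<close> in the
        next one, so monotonicity of \<open>c\<close> orders them.\<close>
      have "- i < j" using mono[of j "- i"] a by (force simp: F_def)
      then show "(i', j') \<in> F m" using join'[of i j' i' j] a by (auto simp: F_def)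
    qed fact
    have "card (fst ` F m) \<le> card (Xm m)" "card (snd ` F m) \<le> card (Xm (Suc m))"
      unfolding Xm_def by (rule rows cols; auto simp: F_def)+
    then have "?C * (card (fst ` F m) + card (snd ` F m)) \<le> ?C * (card (Xm m) + card (Xm (Suc m)))"
      by (intro mult_le_mono2) simp
    then show ?thesis using card_staircase by (rule order_trans[rotated])
  qed
  \<comment> \<open>An edge covers its own two ends and therefore skips no block.\<close>
  have "E \<subseteq> E0 \<union> (\<Union>m\<in>c ` X. F m)"
  proof clarify
    fix i j assume ij: "(i, j) \<in> E" "(i, j) \<notin> (\<Union>m\<in>c ` X. F m)"
    then have "c j \<le> Suc (c (- i))" using EX[OF ij(1)] by (intro c1) (auto simp: cov_def)
    moreover have "c (- i) \<le> c j" using mono EX[OF ij(1)] by simp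
    moreover have "c j \<noteq> Suc (c (- i))" using ij EX[OF ij(1)] by (auto simp: F_def)
    ultimately show "(i, j) \<in> E0" using ij by (simp add: E0_def)
  qed
  moreover have "finite (E0 \<union> (\<Union>m\<in>c ` X. F m))"
    by (rule finite_subset[OF _ fin]) (auto simp: E0_def F_def)
  ultimately have "card E \<le> card (E0 \<union> (\<Union>m\<in>c ` X. F m))" by (intro card_mono)
  also have "\<dots> \<le> card E0 + card (\<Union>m\<in>c ` X. F m)" by (rule card_Un_le)
  also have "card (\<Union>m\<in>c ` X. F m) \<le> (\<Sum>m\<in>c ` X. card (F m))" using finX by (intro card_UN_le) simp
  also have "\<dots> \<le> (\<Sum>m\<in>c ` X. ?C * (card (Xm m) + card (Xm (Suc m))))" using F by (intro sum_mono)
  also have "\<dots> = ?C * ((\<Sum>m\<in>c ` X. card (Xm m)) + (\<Sum>m\<in>c ` X. card (Xm (Suc m))))"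
    by (simp add: sum_distrib_left[symmetric] sum.distrib)
  \<comment> \<open>Every block occurs at most once as a left block and at most once as a right
    block.\<close>
  also have "\<dots> \<le> ?C * (card X + card X)"
  proof (intro mult_le_mono2 add_mono)
    show "(\<Sum>m\<in>c ` X. card (Xm m)) \<le> card X"
      unfolding Xm_def using finX by (intro sum_card_fibers_le) auto
    have "(\<Sum>m\<in>c ` X. card (Xm (Suc m))) = (\<Sum>m\<in>Suc ` c ` X. card (Xm m))"
      by (simp add: sum.reindex)
    also have "\<dots> \<le> card X"
      unfolding Xm_def using finX by (intro sum_card_fibers_le) auto
    finally show "(\<Sum>m\<in>c ` X. card (Xm (Suc m))) \<le> card X" .
  qed
  finally show ?thesis using E0 by (simp add: algebra_simps)
qed

section \<open>Visibility between two function graphs\<close>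

lemma affine_le:
  fixes \<alpha> \<beta> \<alpha>' \<beta>' :: real
  assumes "\<alpha> + \<beta> * a \<le> \<alpha>' + \<beta>' * a" "\<alpha> + \<beta> * b \<le> \<alpha>' + \<beta>' * b" "a \<le> z" "z \<le> b"
  shows "\<alpha> + \<beta> * z \<le> \<alpha>' + \<beta>' * z"
proof (cases "\<beta> \<le> \<beta>'")
  case True
  then have "(\<beta>' - \<beta>) * a \<le> (\<beta>' - \<beta>) * z" using assms by (intro mult_left_mono) auto
  then show ?thesis using assms by (simp add: algebra_simps)
next
  case False
  then have "(\<beta> - \<beta>') * z \<le> (\<beta> - \<beta>') * b" using assms by (intro mult_left_mono) auto
  then show ?thesis using assms by (simp add: algebra_simps)
qed

text \<open>Visibility for \<open>fst p < fst q\<close>, expressed by the line through the two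
  points as a graph over the abscissa, so that all comparisons are between affine functions.\<close>

definition vis :: "(real \<Rightarrow> real) \<Rightarrow> (real \<Rightarrow> real) \<Rightarrow> pt \<Rightarrow> pt \<Rightarrow> bool" where
  "vis l u p q \<longleftrightarrow> (\<exists>\<alpha> \<beta>. \<alpha> + \<beta> * fst p = snd p \<and> \<alpha> + \<beta> * fst q = snd q \<and>
     (\<forall>z. fst p \<le> z \<longrightarrow> z \<le> fst q \<longrightarrow> l z \<le> \<alpha> + \<beta> * z \<and> \<alpha> + \<beta> * z \<le> u z))"

lemma ex_affine:
  fixes x x' y y' :: real
  assumes "x \<noteq> x'"
  shows "\<exists>\<alpha> \<beta>. \<alpha> + \<beta> * x = y \<and> \<alpha> + \<beta> * x' = y'"
proof -
  obtain b where "b * (x' - x) = y' - y" using assms by (metis nonzero_eq_divide_eq right_minus_eq)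
  then have "(y - b * x) + b * x = y \<and> (y - b * x) + b * x' = y'" by (simp add: algebra_simps)
  then show ?thesis by blast
qed

text \<open>Reflection in the horizontal axis exchanges the two chains; it transfers the bounds for
  upper-upper and lower-upper pairs to lower-lower and upper-lower pairs.\<close>

lemma vis_reflect:
  "vis (\<lambda>x. - u x) (\<lambda>x. - l x) (x, - y) (x', - y') \<longleftrightarrow> vis l u (x, y) (x', y')"
proof -
  have *: "vis (\<lambda>x. - u x) (\<lambda>x. - l x) (x, - y) (x', - y')" if "vis l u (x, y) (x', y')" for l u x y x' y'
  proof -
    obtain \<alpha> \<beta> where "\<alpha> + \<beta> * x = y" "\<alpha> + \<beta> * x' = y'"
      "\<And>z. x \<le> z \<Longrightarrow> z \<le> x' \<Longrightarrow> l z \<le> \<alpha> + \<beta> * z \<and> \<alpha> + \<beta> * z \<le> u z"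
      using \<open>vis l u (x, y) (x', y')\<close> unfolding vis_def by auto
    then show ?thesis unfolding vis_def
      by (intro exI[of _ "- \<alpha>"] exI[of _ "- \<beta>"]) force
  qed
  show ?thesis using *[of l u x y x' y'] *[of "\<lambda>x. - u x" "\<lambda>x. - l x" x "- y" x' "- y'"] by auto
qed

text \<open>The new segment shares its left end with the segment from \<open>p\<close> to
  \<open>q'\<close> and lies above it, hence above \<open>l\<close>. It shares its right end with
  the segment from \<open>p'\<close> to \<open>q\<close> and lies below it, hence below
  \<open>u\<close>.\<close>

lemma vis_lower_upper_closed:
  assumes "vis l u (p', l p') (q, u q)" "vis l u (p, l p) (q', u q')" "p' \<le> p" "p < q" "q \<le> q'"
  shows "vis l u (p, l p) (q, u q)"
proof -
  obtain a1 b1 where 1: "a1 + b1 * q = u q" "\<And>z. p' \<le> z \<Longrightarrow> z \<le> q \<Longrightarrow> l z \<le> a1 + b1 * z \<and> a1 + b1 * z \<le> u z"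
    using assms(1) by (auto simp: vis_def)
  obtain a2 b2 where 2: "a2 + b2 * p = l p" "\<And>z. p \<le> z \<Longrightarrow> z \<le> q' \<Longrightarrow> l z \<le> a2 + b2 * z \<and> a2 + b2 * z \<le> u z"
    using assms(2) by (auto simp: vis_def)
  obtain a b where 0: "a + b * p = l p" "a + b * q = u q" using ex_affine[of p q] assms(4) by blast
  have "l z \<le> a + b * z \<and> a + b * z \<le> u z" if "p \<le> z" "z \<le> q" for z
  proof
    have "a2 + b2 * z \<le> a + b * z"
      using affine_le[OF _ _ that] 0 2(1) 2(2)[of q] assms by auto
    then show "l z \<le> a + b * z" using 2(2)[of z] that assms by auto
    have "a + b * z \<le> a1 + b1 * z"
      using affine_le[OF _ _ that] 0 1(1) 1(2)[of p] assms by auto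
    then show "a + b * z \<le> u z" using 1(2)[of z] that assms by auto
  qed
  then show ?thesis using 0 by (auto simp: vis_def)
qed

text \<open>The new segment starts and ends on or above the spanning segment and so stays above
  \<open>l\<close>. The two crossing lines compare in opposite ways at \<open>p2\<close> and
  \<open>p3\<close>, so the second has the smaller or equal slope; extending both comparisons
  outwards to \<open>p1\<close> and \<open>p4\<close> places the new segment below both
  lines.\<close>

lemma vis_upper_upper_join:
  assumes v13: "vis l u (p1, u p1) (p3, u p3)" and v24: "vis l u (p2, u p2) (p4, u p4)"
    and v: "vis l u (P, u P) (Q, u Q)"
    and ord: "P \<le> p1" "p1 < p2" "p2 < p3" "p3 < p4" "p4 \<le> Q"
  shows "vis l u (p1, u p1) (p4, u p4)"
proof -
  obtain a0 b0 where 0: "\<And>z. P \<le> z \<Longrightarrow> z \<le> Q \<Longrightarrow> l z \<le> a0 + b0 * z \<and> a0 + b0 * z \<le> u z"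
    using v by (auto simp: vis_def)
  obtain a1 b1 where 1: "a1 + b1 * p1 = u p1" "a1 + b1 * p3 = u p3"
      "\<And>z. p1 \<le> z \<Longrightarrow> z \<le> p3 \<Longrightarrow> a1 + b1 * z \<le> u z"
    using v13 by (auto simp: vis_def)
  obtain a2 b2 where 2: "a2 + b2 * p2 = u p2" "a2 + b2 * p4 = u p4"
      "\<And>z. p2 \<le> z \<Longrightarrow> z \<le> p4 \<Longrightarrow> a2 + b2 * z \<le> u z"
    using v24 by (auto simp: vis_def)
  obtain a b where ab: "a + b * p1 = u p1" "a + b * p4 = u p4" using ex_affine[of p1 p4] ord by fastforce
  have at2: "a1 + b1 * p2 \<le> a2 + b2 * p2" using 1(3)[of p2] 2(1) ord by auto
  have at3: "a2 + b2 * p3 \<le> a1 + b1 * p3" using 2(3)[of p3] 1(2) ord by auto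
  have "(b2 - b1) * (p3 - p2) \<le> 0" using at2 at3 by (simp add: algebra_simps)
  then have slope: "b2 \<le> b1" using ord by (simp add: mult_le_0_iff)
  have "(b1 - b2) * p1 \<le> (b1 - b2) * p2" using slope ord by (intro mult_left_mono) auto
  then have at1: "a1 + b1 * p1 \<le> a2 + b2 * p1" using at2 by (simp add: algebra_simps)
  have "(b1 - b2) * p3 \<le> (b1 - b2) * p4" using slope ord by (intro mult_left_mono) auto
  then have at4: "a2 + b2 * p4 \<le> a1 + b1 * p4" using at3 by (simp add: algebra_simps)
  have "l z \<le> a + b * z \<and> a + b * z \<le> u z" if z: "p1 \<le> z" "z \<le> p4" for z
  proof
    have "a0 + b0 * z \<le> a + b * z"
      using affine_le[OF _ _ z, of a0 b0 a b] ab 0[of p1] 0[of p4] ord by auto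
    then show "l z \<le> a + b * z" using 0[of z] z ord by auto
    have "a + b * z \<le> a1 + b1 * z" using affine_le[OF _ _ z, of a b a1 b1] ab 1(1) 2(2) at4 by simp
    moreover have "a + b * z \<le> a2 + b2 * z" using affine_le[OF _ _ z, of a b a2 b2] ab 1(1) 2(2) at1 by simp
    \<comment> \<open>The two crossing segments together cover the range from \<open>p1\<close> to
      \<open>p4\<close>; each of them is below \<open>u\<close> over its own part.\<close>
    ultimately show "a + b * z \<le> u z"
      using 1(3)[of z] 2(3)[of z] z ord by (cases "z \<le> p3") auto
  qed
  then show ?thesis using ab by (auto simp: vis_def)
qed

text \<open>The constant obtained for one chain; it also dominates the constant
  \<open>k + k * k\<close> for edges between the chains.\<close>

definition edge_bound :: "nat \<Rightarrow> nat" where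
  "edge_bound k = 2 * k + 2 * (2 * k + k * k + (k + k * k) * (k + k * k))"

lemma card_neg_fst:
  fixes F :: "(real \<times> real) set"
  shows "card {(- x, y) | x y. (x, y) \<in> F} = card F"
proof -
  have "{(- x, y) | x y. (x, y) \<in> F} = (\<lambda>(x, y). (- x, y)) ` F" by auto
  moreover have "inj_on (\<lambda>(x, y). (- x, y)) F" by (auto simp: inj_on_def)
  ultimately show ?thesis by (simp add: card_image)
qed

lemma biclique_free_neg_fst:
  assumes "biclique_free F k"
  shows "biclique_free {(- x, y) | x y. (x, y) \<in> F} k"
  unfolding biclique_free_def
proof clarify
  fix A B :: "real set" assume "k = card A" "card B = card A" and "A \<times> B \<subseteq> {(- x, y) | x y. (x, y) \<in> F}"
  moreover have "card (uminus ` A) = card A" by (intro card_image) auto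
  moreover have "uminus ` A \<times> B \<subseteq> F" using \<open>A \<times> B \<subseteq> _\<close> by fastforce
  ultimately show False using assms unfolding biclique_free_def by metis
qed

text \<open>Negating the left abscissa makes longer edges larger in both coordinates, so a spanning
  edge becomes an entry dominating the join.\<close>

lemma card_upper_upper:
  assumes "finite X" "0 < k" and "biclique_free F k"
    and F: "F = {(x, y). x \<in> X \<and> y \<in> X \<and> x < y \<and> vis l u (x, u x) (y, u y)}"
  shows "card F \<le> edge_bound k * card X"
proof -
  let ?E = "{(- x, y) | x y. (x, y) \<in> F}"
  have "card ?E \<le> edge_bound k * card X"
    unfolding edge_bound_def
  proof (rule card_biclique_free_terrain[OF assms(1,2) biclique_free_neg_fst[OF assms(3)]])
    show "- i \<in> X \<and> j \<in> X \<and> - i < j" if "(i, j) \<in> ?E" for i j using that F by auto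
    fix i j i' j' I J assume a: "(i, j') \<in> ?E" "(i', j) \<in> ?E" "i < i'" "j < j'" "- i < j"
        "(I, J) \<in> ?E" "i' \<le> I" "j' \<le> J"
    then have m: "(- i, j') \<in> F" "(- i', j) \<in> F" "(- I, J) \<in> F" by auto
    then have "vis l u (- i', u (- i')) (j', u j')"
      using vis_upper_upper_join[of l u "- i'" j "- i" j' "- I" J] a F by auto
    then have "(- i', j') \<in> F" using m a F by auto
    then show "(i', j') \<in> ?E" by force
  qed
  then show ?thesis by (simp add: card_neg_fst)
qed

lemma card_lower_upper:
  assumes "finite X" "finite Y" "0 < k" and "biclique_free F k"
    and F: "F = {(x, y). x \<in> X \<and> y \<in> Y \<and> x < y \<and> vis l u (x, l x) (y, u y)}"
  shows "card F \<le> edge_bound k * (card X + card Y)"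
proof -
  let ?E = "{(- x, y) | x y. (x, y) \<in> F}"
  have sub: "?E \<subseteq> (uminus ` X) \<times> Y" using F by auto
  have "card ?E \<le> (k + k * k) * (card (fst ` ?E) + card (snd ` ?E))"
  proof (rule card_biclique_free_hooks[OF _ assms(3) biclique_free_neg_fst[OF assms(4)]])
    show "finite ?E" using sub by (rule finite_subset) (use assms in simp)
    show "0 < i + j" if "(i, j) \<in> ?E" for i j using that F by auto
    fix i j i' j' assume a: "(i', j) \<in> ?E" "(i, j') \<in> ?E" "i \<le> i'" "j \<le> j'" "0 < i + j"
    then have m: "(- i', j) \<in> F" "(- i, j') \<in> F" by auto
    then have "vis l u (- i, l (- i)) (j, u j)"
      using vis_lower_upper_closed[of l u "- i'" j "- i" j'] a F by auto
    then have "(- i, j) \<in> F" using m a F by auto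
    then show "(i, j) \<in> ?E" by force
  qed
  also have "\<dots> \<le> edge_bound k * (card X + card Y)"
  proof (intro mult_mono add_mono)
    show "k + k * k \<le> edge_bound k" by (simp add: edge_bound_def)
    have "fst ` ?E \<subseteq> uminus ` X" using sub by fastforce
    then show "card (fst ` ?E) \<le> card X" using assms(1) by (intro surj_card_le) auto
    have "snd ` ?E \<subseteq> Y" using sub by fastforce
    then show "card (snd ` ?E) \<le> card Y" using assms(2) by (intro card_mono) auto
  qed auto
  finally show ?thesis by (simp add: card_neg_fst)
qed

section \<open>Monotone polygons as regions between two graphs\<close>

locale monotone_polygon =
  fixes vs :: "pt list"
  assumes simple: "simple_polygon vs" and mono: "x_monotone vs"
begin

abbreviation n :: nat where "n \<equiv> length vs"

abbreviation B :: "pt set" where "B \<equiv> poly_boundary vs"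

lemma length_ge: "3 \<le> n"
  using simple by (simp add: simple_polygon_def)

lemma n_pos: "0 < n"
  using length_ge by linarith

lemma finite_slice: "finite {p \<in> B. fst p = x}" and card_slice: "card {p \<in> B. fst p = x} \<le> 2"
  using mono by (auto simp: x_monotone_def)

lemma slice_not_three:
  assumes "p \<in> B" "q \<in> B" "r \<in> B" "fst p = x" "fst q = x" "fst r = x"
  shows "p = q \<or> p = r \<or> q = r"
proof (rule ccontr)
  assume "\<not> ?thesis"
  then have "card {p, q, r} = 3" by auto
  moreover have "card {p, q, r} \<le> card {p \<in> B. fst p = x}"
    using assms finite_slice by (intro card_mono) auto
  ultimately show False using card_slice[of x] by simp
qed

lemma edge_subset: "i < n \<Longrightarrow> poly_edge vs i \<subseteq> B"
  by (auto simp: poly_boundary_def)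

lemma edge_start: "vs ! i \<in> poly_edge vs i"
  and edge_end: "vs ! ((i + 1) mod n) \<in> poly_edge vs i"
  by (auto simp: poly_edge_def)

lemma edge_last: "vs ! 0 \<in> poly_edge vs (n - 1)"
proof -
  have "n - 1 + 1 = n" using n_pos by simp
  then show ?thesis using edge_end[of "n - 1"] by simp
qed

text \<open>A vertical edge would put infinitely many boundary points on one vertical line.\<close>

lemma edge_not_vertical:
  assumes "i < n"
  shows "fst (vs ! i) \<noteq> fst (vs ! ((i + 1) mod n))"
proof
  let ?p = "vs ! i" and ?q = "vs ! ((i + 1) mod n)"
  assume eq: "fst ?p = fst ?q"
  have "i \<noteq> (i + 1) mod n" using length_ge assms by (auto simp: mod_Suc)
  moreover have "(i + 1) mod n < n" using n_pos by simp
  ultimately have "?p \<noteq> ?q"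
    using simple assms by (auto simp: simple_polygon_def nth_eq_iff_index_eq)
  then have "infinite (closed_segment ?p ?q)"
    using uncountable_closed_segment countable_finite by blast
  moreover have "closed_segment ?p ?q \<subseteq> {p \<in> B. fst p = fst ?p}"
  proof
    fix z assume z: "z \<in> closed_segment ?p ?q"
    then obtain w where "z = (1 - w) *\<^sub>R ?p + w *\<^sub>R ?q" by (auto simp: in_segment)
    then have "fst z = (1 - w) * fst ?p + w * fst ?p" using eq by simp
    then have "fst z = fst ?p" by (simp add: algebra_simps)
    then show "z \<in> {p \<in> B. fst p = fst ?p}" using z edge_subset[OF assms] by (auto simp: poly_edge_def)
  qed
  ultimately show False using finite_slice finite_subset by blast
qed

lemma edge_inter:
  assumes "i < n" "j < n" "i \<noteq> j" "z \<in> poly_edge vs i" "z \<in> poly_edge vs j"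
  shows "j = (i + 1) mod n \<and> z = vs ! j \<or> i = (j + 1) mod n \<and> z = vs ! i"
proof -
  have "if j = (i + 1) mod n then poly_edge vs i \<inter> poly_edge vs j = {vs ! j}
         else if i = (j + 1) mod n then poly_edge vs i \<inter> poly_edge vs j = {vs ! i}
         else poly_edge vs i \<inter> poly_edge vs j = {}"
    using simple assms(1-3) unfolding simple_polygon_def by blast
  then show ?thesis using assms(4,5) by (auto split: if_splits)
qed

lemma edge_attains:
  assumes "\<sigma> * fst (vs ! i) \<le> t \<and> t \<le> \<sigma> * fst (vs ! ((i + 1) mod n))
    \<or> \<sigma> * fst (vs ! ((i + 1) mod n)) \<le> t \<and> t \<le> \<sigma> * fst (vs ! i)"
  shows "\<exists>z\<in>poly_edge vs i. \<sigma> * fst z = t"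
proof -
  let ?f = "\<lambda>z :: pt. \<sigma> * fst z"
  have "connected (?f ` poly_edge vs i)"
    unfolding poly_edge_def by (intro connected_continuous_image continuous_intros) auto
  then have "t \<in> ?f ` poly_edge vs i"
    using assms connected_contains_Icc[of "?f ` poly_edge vs i"] edge_start[of i] edge_end[of i]
    by (meson atLeastAtMost_iff imageI subsetD)
  then show ?thesis by auto
qed

text \<open>The value at \<open>z\<close> is a convex combination of the values at the ends. It can
  equal the lower bound \<open>a\<close> only at an end, since the edge is not vertical and the two
  ends cannot both attain \<open>a\<close>.\<close>

lemma edge_fst_ge:
  assumes "z \<in> poly_edge vs i" and "\<sigma> \<noteq> 0"
    and "a \<le> \<sigma> * fst (vs ! i)" "a \<le> \<sigma> * fst (vs ! ((i + 1) mod n))"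
  shows "a \<le> \<sigma> * fst z"
    and "\<sigma> * fst z = a \<Longrightarrow> i < n \<Longrightarrow> z = vs ! i \<or> z = vs ! ((i + 1) mod n)"
proof -
  let ?p = "vs ! i" and ?q = "vs ! ((i + 1) mod n)"
  obtain w where w: "0 \<le> w" "w \<le> 1" "z = (1 - w) *\<^sub>R ?p + w *\<^sub>R ?q"
    using assms(1) by (auto simp: poly_edge_def in_segment)
  have eq: "\<sigma> * fst z = (1 - w) * (\<sigma> * fst ?p) + w * (\<sigma> * fst ?q)" unfolding w(3) by (simp add: algebra_simps)
  have 1: "(1 - w) * a \<le> (1 - w) * (\<sigma> * fst ?p)" "w * a \<le> w * (\<sigma> * fst ?q)"
    using w assms by (auto intro!: mult_left_mono)
  have a: "a = (1 - w) * a + w * a" by (simp add: algebra_simps)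
  show "a \<le> \<sigma> * fst z" using 1 a eq by linarith
  assume min: "\<sigma> * fst z = a" and "i < n"
  have "(1 - w) * a = (1 - w) * (\<sigma> * fst ?p)" "w * a = w * (\<sigma> * fst ?q)" using 1 a eq min by linarith+
  then have "w = 1 \<or> a = \<sigma> * fst ?p" "w = 0 \<or> a = \<sigma> * fst ?q" by auto
  moreover have "\<not> (a = \<sigma> * fst ?p \<and> a = \<sigma> * fst ?q)"
    using edge_not_vertical[OF \<open>i < n\<close>] \<open>\<sigma> \<noteq> 0\<close> by auto
  ultimately show "z = ?p \<or> z = ?q" using w by auto
qed

lemma pred_index:
  assumes "i < n"
  obtains h where "h < n" "(h + 1) mod n = i" "h \<noteq> i"
proof (cases i)
  case 0
  have "n - 1 + 1 = n" using n_pos by simp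
  then have "(n - 1 + 1) mod n = 0" by simp
  then show thesis using that[of "n - 1"] length_ge 0 by simp
next
  case (Suc h)
  then show thesis using that[of h] assms by auto
qed

lemma boundary_fst_ge:
  assumes "\<sigma> \<noteq> 0" and "\<And>i. i < n \<Longrightarrow> a \<le> \<sigma> * fst (vs ! i)" and "z \<in> B"
  shows "a \<le> \<sigma> * fst z"
    and "\<sigma> * fst z = a \<Longrightarrow> \<exists>i<n. z = vs ! i"
proof -
  obtain i where i: "i < n" "z \<in> poly_edge vs i" using assms(3) by (auto simp: poly_boundary_def)
  have i': "(i + 1) mod n < n" using n_pos by simp
  show "a \<le> \<sigma> * fst z" using edge_fst_ge(1)[OF i(2) assms(1)] assms(2) i i' by blast
  show "\<exists>i<n. z = vs ! i" if "\<sigma> * fst z = a"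
    using edge_fst_ge(2)[OF i(2) assms(1) _ _ that] assms(2) i i' by blast
qed

text \<open>
  The factor \<open>\<sigma> = \<plusminus>1\<close> treats the left and the right end together. Two different extreme
  vertices would have three edges leaving them, hence three boundary points on a nearby vertical line.
\<close>

lemma extreme_unique:
  assumes "\<sigma> \<noteq> 0" and min: "\<And>i. i < n \<Longrightarrow> a \<le> \<sigma> * fst (vs ! i)"
    and z: "z \<in> B" "\<sigma> * fst z = a" and z': "z' \<in> B" "\<sigma> * fst z' = a"
  shows "z = z'"
proof (rule ccontr)
  assume "z \<noteq> z'"
  obtain i where i: "i < n" "z = vs ! i" using boundary_fst_ge(2)[OF assms(1) min z] by blast
  obtain j where j: "j < n" "z' = vs ! j" using boundary_fst_ge(2)[OF assms(1) min z'] by blast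
  have ij: "i \<noteq> j" using \<open>z \<noteq> z'\<close> i j by auto
  \<comment> \<open>The three edges are \<open>h\<close> and \<open>i\<close>, which share the
    extreme vertex \<open>vs ! i\<close>, and \<open>j\<close>. Edge \<open>h\<close> differs from
    \<open>j\<close> because it is not vertical and so starts at a vertex that is not
    extreme.\<close>
  obtain h where h: "h < n" "(h + 1) mod n = i" "h \<noteq> i" using pred_index[OF i(1)] .
  have hi: "fst (vs ! h) \<noteq> fst (vs ! i)" using edge_not_vertical[OF h(1)] h(2) by simp
  have hj: "h \<noteq> j" using hi i j z z' assms(1) by auto
  let ?W = "{\<sigma> * fst (vs ! m) | m. m < n \<and> \<sigma> * fst (vs ! m) \<noteq> a}"
  have "finite ?W" by (rule finite_subset[of _ "(\<lambda>m. \<sigma> * fst (vs ! m)) ` {..<n}"]) auto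
  moreover have "\<sigma> * fst (vs ! h) \<in> ?W" using h(1) hi z(2) i(2) assms(1) by auto
  ultimately have W: "Min ?W \<in> ?W" "\<And>w. w \<in> ?W \<Longrightarrow> Min ?W \<le> w" using Min_in[of ?W] by auto
  \<comment> \<open>Halfway between the extreme value and the next vertex value: no vertex lies at
    \<open>t\<close>, and every edge with an extreme end crosses it.\<close>
  define t where "t = (a + Min ?W) / 2"
  have "a < Min ?W" using W(1) min by force
  then have t: "a < t" "t < Min ?W" by (auto simp: t_def)
  have notv: "\<sigma> * fst (vs ! m) \<noteq> t" if "m < n" for m
  proof
    assume "\<sigma> * fst (vs ! m) = t"
    then have "t \<in> ?W" using that t by auto
    then show False using W(2)[OF \<open>t \<in> ?W\<close>] t by linarith
  qed
  have step: "\<exists>y\<in>poly_edge vs m. \<sigma> * fst y = t"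
    if "m < n" "\<sigma> * fst (vs ! m) = a \<or> \<sigma> * fst (vs ! ((m + 1) mod n)) = a" for m
  proof -
    have m': "(m + 1) mod n < n" using n_pos by simp
    have ne: "\<sigma> * fst (vs ! m) \<noteq> \<sigma> * fst (vs ! ((m + 1) mod n))"
      using edge_not_vertical[OF that(1)] assms(1) by simp
    show ?thesis using that(2)
    proof
      assume *: "\<sigma> * fst (vs ! m) = a"
      then have "\<sigma> * fst (vs ! ((m + 1) mod n)) \<in> ?W" using m' ne by auto
      from W(2)[OF this] show ?thesis using t * by (intro edge_attains) linarith
    next
      assume *: "\<sigma> * fst (vs ! ((m + 1) mod n)) = a"
      then have "\<sigma> * fst (vs ! m) \<in> ?W" using that(1) ne by auto
      from W(2)[OF this] show ?thesis using t * by (intro edge_attains) linarith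
    qed
  qed
  \<comment> \<open>Different edges meet only in vertices, and no vertex lies at
    \<open>t\<close>.\<close>
  have dist: "y \<noteq> y'"
    if "m < n" "m' < n" "m \<noteq> m'" "y \<in> poly_edge vs m" "y' \<in> poly_edge vs m'" "\<sigma> * fst y = t" for m m' y y'
    using edge_inter[of m m' y] notv that by auto
  obtain y1 where 1: "y1 \<in> poly_edge vs i" "\<sigma> * fst y1 = t" using step[of i] i z by auto
  obtain y2 where 2: "y2 \<in> poly_edge vs h" "\<sigma> * fst y2 = t" using step[of h] i h z by auto
  obtain y3 where 3: "y3 \<in> poly_edge vs j" "\<sigma> * fst y3 = t" using step[of j] j z' by auto
  have "y1 \<noteq> y2" "y1 \<noteq> y3" "y2 \<noteq> y3" using dist 1 2 3 i h j ij hj by metis+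
  moreover have "fst y1 = t / \<sigma>" "fst y2 = t / \<sigma>" "fst y3 = t / \<sigma>" using 1 2 3 assms(1) by (auto simp: field_simps)
  moreover have "y1 \<in> B" "y2 \<in> B" "y3 \<in> B" using 1 2 3 i h j edge_subset by blast+
  ultimately show False using slice_not_three by blast
qed

section \<open>Cutting the boundary into two arcs\<close>

definition edge_union :: "nat set \<Rightarrow> pt set" where
  "edge_union M = (\<Union>m\<in>M. poly_edge vs m)"

lemma connected_edge_union:
  assumes "s < e" "e \<le> n"
  shows "connected (edge_union {s..<e})"
  using assms
proof (induction e)
  case (Suc e)
  have edge: "connected (poly_edge vs m)" for m by (simp add: poly_edge_def)
  show ?case
  proof (cases "s = e")
    case True
    then have "{s..<Suc e} = {e}" by auto
    then show ?thesis using edge by (simp add: edge_union_def)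
  next
    case False
    then have "edge_union {s..<Suc e} = edge_union {s..<e} \<union> poly_edge vs e"
      using Suc.prems by (auto simp: edge_union_def atLeastLessThanSuc)
    moreover have "vs ! e \<in> edge_union {s..<e}"
      using edge_end[of "e - 1"] Suc.prems False by (auto simp: edge_union_def intro!: bexI[of _ "e - 1"])
    ultimately show ?thesis
      using Suc False edge edge_start[of e] by (auto intro!: connected_Un)
  qed
qed simp

lemma compact_edge_union: "finite M \<Longrightarrow> compact (edge_union M)"
  by (auto simp: edge_union_def poly_edge_def)

text \<open>One arc consists of the edges from index \<open>p\<close> to \<open>q - 1\<close>, the
  other of the remaining edges. A common point lies on two cyclically consecutive edges of different
  arcs, so it is one of the two cutting vertices.\<close>

lemma two_arcs:
  assumes pq: "p < q" "q < n"
  obtains A1 A2 where "A1 \<union> A2 = B" "A1 \<inter> A2 \<subseteq> {vs ! p, vs ! q}" "vs ! p \<in> A1 \<inter> A2" "vs ! q \<in> A1 \<inter> A2"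
    "connected A1" "connected A2" "compact A1" "compact A2"
proof
  let ?A1 = "edge_union {p..<q}" and ?A2 = "edge_union ({0..<p} \<union> {q..<n})"
  have "{p..<q} \<union> ({0..<p} \<union> {q..<n}) = {..<n}" using pq by auto
  then show "?A1 \<union> ?A2 = B" unfolding edge_union_def poly_boundary_def by (metis UN_Un)
  show "?A1 \<inter> ?A2 \<subseteq> {vs ! p, vs ! q}"
  proof
    fix z assume "z \<in> ?A1 \<inter> ?A2"
    then obtain m m' where m: "m \<in> {p..<q}" "z \<in> poly_edge vs m"
      and m': "m' \<in> {0..<p} \<union> {q..<n}" "z \<in> poly_edge vs m'"
      unfolding edge_union_def by blast
    have "m' = (m + 1) mod n \<and> z = vs ! m' \<or> m = (m' + 1) mod n \<and> z = vs ! m"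
      using edge_inter[of m m' z] m m' pq by auto
    then show "z \<in> {vs ! p, vs ! q}"
    proof
      assume "m' = (m + 1) mod n \<and> z = vs ! m'"
      moreover have "(m + 1) mod n = m + 1" using m pq by auto
      ultimately have "m' = q" using m m' by auto
      then show ?thesis using \<open>m' = _ \<and> _\<close> by simp
    next
      assume a: "m = (m' + 1) mod n \<and> z = vs ! m"
      have "m = p"
      proof (cases "m' + 1 = n")
        case True
        then show ?thesis using a m by simp
      next
        case False
        then have "m = m' + 1" using a m' pq by auto
        then show ?thesis using m m' by auto
      qed
      then show ?thesis using a by simp
    qed
  qed
  have "vs ! p \<in> ?A1" using edge_start[of p] pq by (auto simp: edge_union_def)
  moreover have p2: "vs ! p \<in> ?A2"
  proof (cases p)
    case 0
    then show ?thesis using edge_last pq by (auto simp: edge_union_def intro!: bexI[of _ "n - 1"])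
  next
    case (Suc h)
    then show ?thesis using edge_end[of h] pq by (auto simp: edge_union_def intro!: bexI[of _ h])
  qed
  ultimately show "vs ! p \<in> ?A1 \<inter> ?A2" by simp
  have "vs ! q \<in> ?A1" using edge_end[of "q - 1"] pq by (auto simp: edge_union_def intro!: bexI[of _ "q - 1"])
  moreover have "vs ! q \<in> ?A2" using edge_start[of q] pq by (auto simp: edge_union_def)
  ultimately show "vs ! q \<in> ?A1 \<inter> ?A2" by simp
  show "connected ?A1" using pq by (intro connected_edge_union) auto
  \<comment> \<open>For \<open>p = 0\<close> the second arc is a single run of edges; otherwise its
    two runs meet at the vertex \<open>vs ! 0\<close>.\<close>
  show "connected ?A2"
  proof (cases "p = 0")
    case True
    then show ?thesis using connected_edge_union[of q n] pq by simp
  next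
    case False
    have "?A2 = edge_union {0..<p} \<union> edge_union {q..<n}" by (auto simp: edge_union_def)
    moreover have "vs ! 0 \<in> edge_union {0..<p}" using edge_start[of 0] False by (auto simp: edge_union_def)
    moreover have "vs ! 0 \<in> edge_union {q..<n}"
      using edge_last pq by (auto simp: edge_union_def intro!: bexI[of _ "n - 1"])
    ultimately show ?thesis
      using connected_Un[of "edge_union {0..<p}" "edge_union {q..<n}"] connected_edge_union[of 0 p] connected_edge_union[of q n] False pq
      by auto
  qed
  show "compact ?A1" "compact ?A2" by (auto intro: compact_edge_union)
qed

text \<open>The projection is a continuous bijection from a compact set onto the interval, so its
  inverse is continuous.\<close>

lemma compact_graph_function:
  fixes A :: "pt set"
  assumes "compact A" "inj_on fst A" "fst ` A = {a..b}"
  obtains f where "continuous_on {a..b} f" "A = (\<lambda>x. (x, f x)) ` {a..b}"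
proof
  let ?g = "inv_into A fst"
  have "continuous_on (fst ` A) ?g"
    using assms by (intro continuous_on_inv continuous_intros) (auto simp: inv_into_f_f)
  then show "continuous_on {a..b} (\<lambda>x. snd (?g x))" using assms(3) by (auto intro!: continuous_intros)
  have g: "?g x \<in> A" "fst (?g x) = x" if "x \<in> {a..b}" for x
    using that assms(3) by (auto intro: inv_into_into f_inv_into_f)
  show "A = (\<lambda>x. (x, snd (?g x))) ` {a..b}"
  proof
    show "A \<subseteq> (\<lambda>x. (x, snd (?g x))) ` {a..b}"
    proof
      fix z assume "z \<in> A"
      then have "z = (fst z, snd (?g (fst z)))" "fst z \<in> {a..b}" using assms by auto
      then show "z \<in> (\<lambda>x. (x, snd (?g x))) ` {a..b}" by (rule image_eqI)
    qed
    show "(\<lambda>x. (x, snd (?g x))) ` {a..b} \<subseteq> A"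
    proof clarify
      fix x assume "x \<in> {a..b}"
      then have "?g x \<in> A" "(x, snd (?g x)) = ?g x" using g by (auto simp: prod_eq_iff)
      then show "(x, snd (?g x)) \<in> A" by simp
    qed
  qed
qed

text \<open>Cut at a leftmost and a rightmost vertex. Each arc is connected and contains both, so it
  projects onto all of \<open>{a..b}\<close>. Over an interior abscissa the other arc already uses
  one of the at most two boundary points, which leaves one point for each arc.\<close>

lemma boundary_two_graphs:
  obtains a b f1 f2 where "continuous_on {a..b} f1" "continuous_on {a..b} f2" "f1 a = f2 a" "f1 b = f2 b"
    "B = {(x, y). a \<le> x \<and> x \<le> b \<and> (y = f1 x \<or> y = f2 x)}"
proof -
  let ?X = "(\<lambda>i. fst (vs ! i)) ` {..<n}"
  have fin: "finite ?X" "?X \<noteq> {}" using n_pos by (auto simp: lessThan_empty_iff)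
  define a where "a = Min ?X"
  define b where "b = Max ?X"
  obtain i where i: "i < n" "fst (vs ! i) = a" using Min_in[OF fin] unfolding a_def by auto
  obtain j where j: "j < n" "fst (vs ! j) = b" using Max_in[OF fin] unfolding b_def by auto
  have amin: "a \<le> 1 * fst (vs ! m)" if "m < n" for m using that fin unfolding a_def by auto
  have bmax: "- b \<le> (- 1) * fst (vs ! m)" if "m < n" for m using that fin unfolding b_def by auto
  define h where "h = (0 + 1) mod n"
  have h: "h < n" "fst (vs ! 0) \<noteq> fst (vs ! h)"
    using edge_not_vertical[OF n_pos] mod_less_divisor[OF n_pos] unfolding h_def by blast+
  have ab: "a < b"
    using h(2) amin[OF n_pos] bmax[OF n_pos] amin[OF h(1)] bmax[OF h(1)] by auto
  have range: "a \<le> fst z \<and> fst z \<le> b" if "z \<in> B" for z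
  proof -
    have "a \<le> 1 * fst z" by (rule boundary_fst_ge(1)[OF _ amin that]) simp_all
    moreover have "- b \<le> (- 1) * fst z" by (rule boundary_fst_ge(1)[OF _ bmax that]) simp_all
    ultimately show ?thesis by linarith
  qed
  have left: "z = z'" if "z \<in> B" "z' \<in> B" "fst z = a" "fst z' = a" for z z'
    by (rule extreme_unique[of 1 a]) (use amin that in simp_all)
  have right: "z = z'" if "z \<in> B" "z' \<in> B" "fst z = b" "fst z' = b" for z z'
    by (rule extreme_unique[of "- 1" "- b"]) (use bmax that in simp_all)
  have ij: "i \<noteq> j" using i j ab by auto
  define p where "p = min i j"
  define q where "q = max i j"
  have pq: "p < q" "q < n" using i j ij by (auto simp: p_def q_def)
  have pq': "{vs ! p, vs ! q} = {vs ! i, vs ! j}" by (auto simp: p_def q_def min_def max_def)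
  obtain A1 A2 where A: "A1 \<union> A2 = B" "A1 \<inter> A2 \<subseteq> {vs ! p, vs ! q}" "vs ! p \<in> A1 \<inter> A2" "vs ! q \<in> A1 \<inter> A2"
    "connected A1" "connected A2" "compact A1" "compact A2"
    using two_arcs[OF pq] .
  have ends: "vs ! i \<in> A1" "vs ! j \<in> A1" "vs ! i \<in> A2" "vs ! j \<in> A2" 
  proof -
    have "{vs ! i, vs ! j} \<subseteq> A1 \<inter> A2" unfolding pq'[symmetric] using A(3,4) by simp
    then show "vs ! i \<in> A1" "vs ! j \<in> A1" "vs ! i \<in> A2" "vs ! j \<in> A2" by auto
  qed
  have img: "fst ` K = {a..b}" if "connected K" "K \<subseteq> B" "vs ! i \<in> K" "vs ! j \<in> K" for K
  proof
    show "fst ` K \<subseteq> {a..b}" using range that(2) by auto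
    have "connected (fst ` K)" using that(1) by (intro connected_continuous_image continuous_intros)
    moreover have "a \<in> fst ` K" "b \<in> fst ` K" using that(3,4) i(2) j(2) by force+
    ultimately show "{a..b} \<subseteq> fst ` K" by (rule connected_contains_Icc)
  qed
  have img1: "fst ` A1 = {a..b}" and img2: "fst ` A2 = {a..b}" using img A ends by auto
  have inj: "inj_on fst K" if "K \<subseteq> B" "K' \<subseteq> B" "fst ` K' = {a..b}" "K \<inter> K' \<subseteq> {vs ! i, vs ! j}" for K K'
  proof (rule inj_onI)
    fix z z' assume z: "z \<in> K" "z' \<in> K" "fst z = fst z'"
    then have zB: "z \<in> B" "z' \<in> B" using that by auto
    consider "fst z = a" | "fst z = b" | "a < fst z" "fst z < b" using range[OF zB(1)] by force
    then show "z = z'"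
    proof cases
      case 1
      then show ?thesis using left zB z by simp
    next
      case 2
      then show ?thesis using right zB z by simp
    next
      case 3
      then have "fst z \<in> fst ` K'" using that(3) by simp
      then obtain w where w: "w \<in> K'" "fst w = fst z" by auto
      have "w \<notin> K" using w that(4) 3 i j by auto
      then have "z \<noteq> w" "z' \<noteq> w" using z by auto
      moreover have "w \<in> B" using w(1) that(2) by blast
      ultimately show ?thesis using slice_not_three[OF zB _ refl z(3)[symmetric] w(2)] by blast
    qed
  qed
  have "A1 \<subseteq> B" "A2 \<subseteq> B" "A1 \<inter> A2 \<subseteq> {vs ! i, vs ! j}" "A2 \<inter> A1 \<subseteq> {vs ! i, vs ! j}"
    using A(1,2) unfolding pq' by auto
  then have inj1: "inj_on fst A1" and inj2: "inj_on fst A2" using inj img1 img2 by blast+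
  obtain f1 where f1: "continuous_on {a..b} f1" "A1 = (\<lambda>x. (x, f1 x)) ` {a..b}"
    using compact_graph_function[OF A(7) inj1 img1] .
  obtain f2 where f2: "continuous_on {a..b} f2" "A2 = (\<lambda>x. (x, f2 x)) ` {a..b}"
    using compact_graph_function[OF A(8) inj2 img2] .
  show thesis
  proof (rule that[OF f1(1) f2(1)])
    have "(a, f1 a) \<in> B" "(a, f2 a) \<in> B" "(b, f1 b) \<in> B" "(b, f2 b) \<in> B"
      unfolding A(1)[symmetric] f1(2) f2(2) using ab by auto
    then show "f1 a = f2 a" "f1 b = f2 b"
      using left[of "(a, f1 a)" "(a, f2 a)"] right[of "(b, f1 b)" "(b, f2 b)"] by auto
    show "B = {(x, y). a \<le> x \<and> x \<le> b \<and> (y = f1 x \<or> y = f2 x)}"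
      unfolding A(1)[symmetric] f1(2) f2(2) by auto
  qed
qed

end

text \<open>A vertical ray from the point that avoids \<open>S\<close> stays in its component of the
  complement, which is then unbounded.\<close>

lemma not_inside_vertical_ray:
  fixes S :: "pt set"
  assumes "(\<forall>y'\<ge>y. (x, y') \<notin> S) \<or> (\<forall>y'\<le>y. (x, y') \<notin> S)"
  shows "(x, y) \<notin> inside S"
proof
  assume "(x, y) \<in> inside S"
  then have bd: "bounded (connected_component_set (- S) (x, y))" by (simp add: inside_def)
  obtain R where R: "R = {y..} \<or> R = {..y}" and avoid: "{x} \<times> R \<subseteq> - S"
    using assms by (metis (no_types, lifting) ComplI SigmaE atLeast_iff atMost_iff singletonD subsetI)
  have "connected ({x} \<times> R)" using R by (intro connected_Times) auto
  then have "{x} \<times> R \<subseteq> connected_component_set (- S) (x, y)"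
    using avoid R by (intro connected_component_maximal) auto
  then have "bounded ({x} \<times> R)" using bd bounded_subset by blast
  then have "bounded (snd ` ({x} \<times> R))" by (rule bounded_snd)
  moreover have "snd ` ({x} \<times> R) = R" by force
  ultimately obtain M where M: "\<And>v. v \<in> R \<Longrightarrow> \<bar>v\<bar> \<le> M" by (auto simp: bounded_iff)
  show False using R M[of "max y (M + 1)"] M[of "min y (- M - 1)"] by auto
qed

text \<open>The component of the point in the complement of the curves is covered by the disjoint
  open sets \<open>U\<close> and \<open>- C\<close>. It meets \<open>U\<close>, so it stays inside
  the bounded set \<open>C\<close>.\<close>

lemma inside_between_graphs:
  fixes l u :: "real \<Rightarrow> real"
  assumes cont: "continuous_on {a..b} l" "continuous_on {a..b} u"
    and ends: "l a = u a" "l b = u b"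
    and z: "a \<le> x" "x \<le> b" "l x < y" "y < u x"
  shows "(x, y) \<in> inside {(x, y). a \<le> x \<and> x \<le> b \<and> (y = l x \<or> y = u x)}"
proof -
  let ?S = "{(x, y). a \<le> x \<and> x \<le> b \<and> (y = l x \<or> y = u x)}"
  define U where "U = {p \<in> {a<..<b} \<times> UNIV. l (fst p) < snd p \<and> snd p < u (fst p)}"
  define C where "C = {p \<in> {a..b} \<times> UNIV. l (fst p) \<le> snd p \<and> snd p \<le> u (fst p)}"
  have co: "continuous_on ({a..b} \<times> UNIV) (\<lambda>p. snd p - f (fst p))" if "continuous_on {a..b} f" for f :: "real \<Rightarrow> real"
    by (intro continuous_intros continuous_on_compose2[OF that]) auto
  have oo: "open ({a<..<b} \<times> (UNIV :: real set))" by (intro open_Times) auto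
  have sub: "{a<..<b} \<times> (UNIV :: real set) \<subseteq> {a..b} \<times> UNIV" by auto
  have "U = ({a<..<b} \<times> UNIV \<inter> (\<lambda>p. snd p - l (fst p)) -` {0<..})
      \<inter> ({a<..<b} \<times> UNIV \<inter> (\<lambda>p. snd p - u (fst p)) -` {..<0})"
    by (auto simp: U_def)
  then have "open U"
    using continuous_open_preimage[OF continuous_on_subset[OF co[OF cont(1)] sub] oo, of "{0<..}"]
      continuous_open_preimage[OF continuous_on_subset[OF co[OF cont(2)] sub] oo, of "{..<0}"] by auto
  have cc: "closed ({a..b} \<times> (UNIV :: real set))" by (intro closed_Times) auto
  have "C = ({a..b} \<times> UNIV \<inter> (\<lambda>p. snd p - l (fst p)) -` {0..})
      \<inter> ({a..b} \<times> UNIV \<inter> (\<lambda>p. snd p - u (fst p)) -` {..0})"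
    by (auto simp: C_def)
  then have "closed C"
    using continuous_closed_preimage[OF co[OF cont(1)] cc, of "{0..}"]
      continuous_closed_preimage[OF co[OF cont(2)] cc, of "{..0}"] by auto
  \<comment> \<open>Over \<open>a\<close> and \<open>b\<close> the two curves meet, so
    \<open>C\<close> has no points there other than those of the curves.\<close>
  have CU: "C - ?S \<subseteq> U"
  proof
    fix p assume p: "p \<in> C - ?S"
    obtain s t where st: "p = (s, t)" by (cases p)
    have *: "a \<le> s" "s \<le> b" "l s \<le> t" "t \<le> u s" "t \<noteq> l s" "t \<noteq> u s" using p st by (auto simp: C_def)
    then have "l s \<noteq> u s" by auto
    then have "s \<noteq> a" "s \<noteq> b" using ends by auto
    then show "p \<in> U" using * st by (auto simp: U_def)
  qed
  let ?K = "connected_component_set (- ?S) (x, y)"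
  have zS: "(x, y) \<notin> ?S" using z by auto
  have "(x, y) \<in> C" using z by (auto simp: C_def)
  then have zU: "(x, y) \<in> U" using CU zS by blast
  have KS: "?K \<subseteq> - ?S" by (rule connected_component_subset)
  have "?K \<subseteq> U \<union> - C" using KS CU by blast
  moreover have "U \<inter> - C \<inter> ?K = {}" by (auto simp: U_def C_def)
  moreover have "U \<inter> ?K \<noteq> {}" using zU zS by auto
  ultimately have "- C \<inter> ?K = {}"
    using connectedD[OF connected_connected_component \<open>open U\<close> open_Compl[OF \<open>closed C\<close>]] by blast
  then have KC: "?K \<subseteq> C" by blast
  have "bounded (l ` {a..b})" "bounded (u ` {a..b})"
    using cont by (auto intro!: compact_imp_bounded compact_continuous_image)
  then have "bounded (l ` {a..b} \<union> u ` {a..b})" by simp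
  then obtain M where M: "\<And>v. v \<in> l ` {a..b} \<union> u ` {a..b} \<Longrightarrow> \<bar>v\<bar> \<le> M"
    unfolding bounded_iff by auto
  have "C \<subseteq> {a..b} \<times> {- M..M}"
  proof
    fix p assume p: "p \<in> C"
    then have "\<bar>l (fst p)\<bar> \<le> M" "\<bar>u (fst p)\<bar> \<le> M" using M by (auto simp: C_def)
    then show "p \<in> {a..b} \<times> {- M..M}" using p by (auto simp: C_def)
  qed
  then have "bounded C" using bounded_subset bounded_Times[of "{a..b}" "{- M..M}"] by auto
  then show ?thesis using KC zS bounded_subset by (auto simp: inside_def)
qed

lemma (in monotone_polygon) boundary_and_region:
  obtains a b l u where
    "B = {(x, y). a \<le> x \<and> x \<le> b \<and> (y = l x \<or> y = u x)}"
    "poly_region vs = {(x, y). a \<le> x \<and> x \<le> b \<and> l x \<le> y \<and> y \<le> u x}"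
proof -
  obtain a b f1 f2 where f: "continuous_on {a..b} f1" "continuous_on {a..b} f2" "f1 a = f2 a" "f1 b = f2 b"
    "B = {(x, y). a \<le> x \<and> x \<le> b \<and> (y = f1 x \<or> y = f2 x)}"
    using boundary_two_graphs .
  \<comment> \<open>Pointwise minimum and maximum give \<open>l x \<le> u x\<close> without deciding
    which arc is the lower one.\<close>
  define l where "l x = min (f1 x) (f2 x)" for x
  define u where "u x = max (f1 x) (f2 x)" for x
  have B: "B = {(x, y). a \<le> x \<and> x \<le> b \<and> (y = l x \<or> y = u x)}"
  proof -
    have "y = l x \<or> y = u x \<longleftrightarrow> y = f1 x \<or> y = f2 x" for x y
      by (cases "f1 x \<le> f2 x") (auto simp: l_def u_def)
    then show ?thesis unfolding f(5) by simp
  qed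
  have le: "l x \<le> u x" for x by (simp add: l_def u_def)
  show thesis
  proof (rule that[OF B])
    show "poly_region vs = {(x, y). a \<le> x \<and> x \<le> b \<and> l x \<le> y \<and> y \<le> u x}" (is "_ = ?R")
    proof
      show "poly_region vs \<subseteq> ?R"
      proof
        fix z assume z: "z \<in> poly_region vs"
        obtain x y where xy: "z = (x, y)" by (cases z)
        show "z \<in> ?R"
        proof (rule ccontr)
          assume no: "z \<notin> ?R"
          have "z \<notin> B" using no xy le B by auto
          then have "(x, y) \<in> inside B" using z xy by (simp add: poly_region_def)
          moreover have "(\<forall>y'\<ge>y. (x, y') \<notin> B) \<or> (\<forall>y'\<le>y. (x, y') \<notin> B)"
            using no xy le[of x] B by auto
          ultimately show False using not_inside_vertical_ray by blast
        qed
      qed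
      show "?R \<subseteq> poly_region vs"
      proof clarify
        fix x y assume xy: "a \<le> x" "x \<le> b" "l x \<le> y" "y \<le> u x"
        show "(x, y) \<in> poly_region vs"
        proof (cases "y = l x \<or> y = u x")
          case True
          then show ?thesis using B xy by (auto simp: poly_region_def)
        next
          case False
          have "(x, y) \<in> inside B"
            unfolding B by (rule inside_between_graphs)
              (use f xy False in \<open>auto simp: l_def u_def intro!: continuous_intros\<close>)
          then show ?thesis by (simp add: poly_region_def)
        qed
      qed
    qed
  qed
qed

section \<open>From visibility in the polygon to the counting bounds\<close>

lemma closed_segment_graph:
  fixes x x' \<alpha> \<beta> :: real
  assumes "x < x'"
  shows "closed_segment (x, \<alpha> + \<beta> * x) (x', \<alpha> + \<beta> * x') = (\<lambda>z. (z, \<alpha> + \<beta> * z)) ` {x..x'}"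
proof -
  have "(\<lambda>z. (z, \<alpha> + \<beta> * z)) ` closed_segment x x'
      = closed_segment (x, \<alpha> + \<beta> * x) (x', \<alpha> + \<beta> * x')"
  proof -
    have "(\<lambda>z. (z, \<alpha> + \<beta> * z)) ` closed_segment x x'
        = (\<lambda>p. (0, \<alpha>) + p) ` (\<lambda>z. (z, \<beta> * z)) ` closed_segment x x'"
      by (simp add: image_image)
    also have "(\<lambda>z. (z, \<beta> * z)) ` closed_segment x x' = closed_segment (x, \<beta> * x) (x', \<beta> * x')"
      by (intro closed_segment_linear_image[symmetric] linearI) (auto simp: algebra_simps)
    also have "(\<lambda>p. (0, \<alpha>) + p) ` \<dots> = closed_segment (x, \<alpha> + \<beta> * x) (x', \<alpha> + \<beta> * x')"
      by (simp add: closed_segment_translation[symmetric])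
    finally show ?thesis .
  qed
  then show ?thesis using assms by (simp add: closed_segment_eq_real_ivl)
qed

lemma sees_iff_vis:
  assumes R: "poly_region vs = {(x, y). a \<le> x \<and> x \<le> b \<and> l x \<le> y \<and> y \<le> u x}"
    and "a \<le> x" "x < x'" "x' \<le> b"
  shows "sees vs (x, y) (x', y') \<longleftrightarrow> vis l u (x, y) (x', y')"
proof -
  have *: "sees vs (x, y) (x', y') \<longleftrightarrow> (\<forall>z. x \<le> z \<longrightarrow> z \<le> x' \<longrightarrow> l z \<le> \<alpha> + \<beta> * z \<and> \<alpha> + \<beta> * z \<le> u z)"
    if "\<alpha> + \<beta> * x = y" "\<alpha> + \<beta> * x' = y'" for \<alpha> \<beta>
  proof -
    have "sees vs (x, y) (x', y') \<longleftrightarrow> closed_segment (x, y) (x', y') \<subseteq> poly_region vs"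
      by (auto simp: sees_def)
    also have "\<dots> \<longleftrightarrow> (\<forall>z\<in>{x..x'}. (z, \<alpha> + \<beta> * z) \<in> poly_region vs)"
      using closed_segment_graph[OF assms(3), of \<alpha> \<beta>] that by auto
    also have "\<dots> \<longleftrightarrow> (\<forall>z. x \<le> z \<longrightarrow> z \<le> x' \<longrightarrow> l z \<le> \<alpha> + \<beta> * z \<and> \<alpha> + \<beta> * z \<le> u z)"
      unfolding R using assms(2-4) by auto
    finally show ?thesis .
  qed
  obtain \<alpha> \<beta> where "\<alpha> + \<beta> * x = y" "\<alpha> + \<beta> * x' = y'" using ex_affine[of x x' y y'] assms(3) by auto
  with * show ?thesis unfolding vis_def by (metis fst_conv snd_conv)
qed

text \<open>Every abscissa of one side of a biclique is smaller than every abscissa of the other, so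
  the two sides lift to disjoint sets of points spanning a forbidden subgraph.\<close>

lemma biclique_free_sees:
  assumes "\<not> contains_Ktt vs V t"
    and F: "\<And>x y. (x, y) \<in> F \<Longrightarrow> x < y \<and> (x, f x) \<in> V \<and> (y, g y) \<in> V \<and> sees vs (x, f x) (y, g y)"
    and "0 < t"
  shows "biclique_free F t"
  unfolding biclique_free_def
proof (intro notI, elim exE conjE)
  fix A B :: "real set" assume AB: "card A = t" "card B = t" "A \<times> B \<subseteq> F"
  let ?A = "(\<lambda>x. (x, f x)) ` A" and ?B = "(\<lambda>x. (x, g x)) ` B"
  have e: "x < y \<and> (x, f x) \<in> V \<and> (y, g y) \<in> V \<and> sees vs (x, f x) (y, g y)" if "x \<in> A" "y \<in> B" for x y
    using F[of x y] AB(3) that by blast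
  have ne: "A \<noteq> {}" "B \<noteq> {}" using AB assms(3) by auto
  have "?A \<subseteq> V" "?B \<subseteq> V" using e ne by blast+
  moreover have "?A \<inter> ?B = {}" using e by force
  moreover have "card ?A = t" "card ?B = t" using AB by (auto simp: card_image inj_on_def)
  moreover have "\<forall>p\<in>?A. \<forall>q\<in>?B. {p, q} \<in> vis_edges vs V"
  proof clarify
    fix x y assume "x \<in> A" "y \<in> B"
    then have "x < y" "(x, f x) \<in> V" "(y, g y) \<in> V" "sees vs (x, f x) (y, g y)" using e by auto
    moreover from this have "(x, f x) \<noteq> (y, g y)" by auto
    ultimately show "{(x, f x), (y, g y)} \<in> vis_edges vs V" unfolding vis_edges_def by blast
  qed
  ultimately show False using assms(1) unfolding contains_Ktt_def by blast
qed

lemma card_vis_edges_le: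
  assumes "simple_polygon vs" "x_monotone vs" "finite V" "V \<subseteq> poly_boundary vs"
    "\<not> contains_Ktt vs V t" "0 < t"
  shows "card (vis_edges vs V) \<le> (3 * edge_bound t + 1) * card V"
proof -
  interpret monotone_polygon vs using assms by unfold_locales
  obtain a b l u where B: "B = {(x, y). a \<le> x \<and> x \<le> b \<and> (y = l x \<or> y = u x)}"
    and R: "poly_region vs = {(x, y). a \<le> x \<and> x \<le> b \<and> l x \<le> y \<and> y \<le> u x}"
    using boundary_and_region .
  \<comment> \<open>A point where the two chains meet is assigned to the lower chain, so that
    \<open>VL\<close> and \<open>VU\<close> partition \<open>V\<close>.\<close>
  define VL where "VL = {p \<in> V. snd p = l (fst p)}"
  define VU where "VU = V - VL"
  define XL where "XL = fst ` VL"
  define XU where "XU = fst ` VU"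
  have fin: "finite XL" "finite XU" using assms(3) by (auto simp: XL_def XU_def VL_def VU_def)
  have VLU: "snd p = u (fst p)" if "p \<in> VU" for p
    using that assms(4) B by (auto simp: VU_def VL_def)
  have XL: "(x, l x) \<in> V" "a \<le> x" "x \<le> b" if "x \<in> XL" for x
    using that assms(4) B by (auto simp: XL_def VL_def)
  have XU: "(x, u x) \<in> V" "a \<le> x" "x \<le> b" if "x \<in> XU" for x
    using that assms(4) B VLU by (fastforce simp: XU_def VU_def)+
  have range: "a \<le> fst p" "fst p \<le> b" if "p \<in> V" for p using that assms(4) B by auto
  define F where "F X f Y g = {(x, y). x \<in> X \<and> y \<in> Y \<and> x < y \<and> vis l u (x, f x) (y, g y)}"
    for X Y :: "real set" and f g :: "real \<Rightarrow> real"
  have free: "biclique_free (F X f Y g) t" if "X = XL \<and> f = l \<or> X = XU \<and> f = u" "Y = XL \<and> g = l \<or> Y = XU \<and> g = u" for X f Y g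
  proof (rule biclique_free_sees[OF assms(5) _ assms(6)])
    fix x y assume "(x, y) \<in> F X f Y g"
    then have "x \<in> X" "y \<in> Y" "x < y" "vis l u (x, f x) (y, g y)" by (auto simp: F_def)
    moreover from this have "(x, f x) \<in> V" "a \<le> x" "(y, g y) \<in> V" "y \<le> b" using that XL XU by auto
    ultimately show "x < y \<and> (x, f x) \<in> V \<and> (y, g y) \<in> V \<and> sees vs (x, f x) (y, g y)"
      using sees_iff_vis[OF R] by simp
  qed
  have UU: "card (F XU u XU u) \<le> edge_bound t * card XU"
    by (rule card_upper_upper[OF fin(2) assms(6) free[of XU u XU u]]) (auto simp: F_def)
  \<comment> \<open>The reflected chains \<open>- u\<close> and \<open>- l\<close> turn lower points
    into upper points.\<close>
  have LL: "card (F XL l XL l) \<le> edge_bound t * card XL"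
    by (rule card_upper_upper[OF fin(1) assms(6) free[of XL l XL l], where l = "\<lambda>x. - u x" and u = "\<lambda>x. - l x"])
       (auto simp: F_def vis_reflect)
  have LU: "card (F XL l XU u) \<le> edge_bound t * (card XL + card XU)"
    by (rule card_lower_upper[OF fin assms(6) free[of XL l XU u]]) (auto simp: F_def)
  have UL: "card (F XU u XL l) \<le> edge_bound t * (card XU + card XL)"
    by (rule card_lower_upper[OF fin(2,1) assms(6) free[of XU u XL l], where l = "\<lambda>x. - u x" and u = "\<lambda>x. - l x"])
       (auto simp: F_def vis_reflect)
  define \<phi> where "\<phi> f g = (\<lambda>(x, y). {(x, f x), (y, g y)})" for f g :: "real \<Rightarrow> real"
  let ?U = "\<phi> u u ` F XU u XU u" and ?L = "\<phi> l l ` F XL l XL l"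
    and ?LU = "\<phi> l u ` F XL l XU u" and ?UL = "\<phi> u l ` F XU u XL l" and ?V = "(\<lambda>x. {(x, l x), (x, u x)}) ` XL"
  have finF: "finite (F X f Y g)" if "finite X" "finite Y" for X Y f g
    by (rule finite_subset[of _ "X \<times> Y"]) (use that in \<open>auto simp: F_def\<close>)
  have ordered: "{p, q} \<in> ?U \<union> ?L \<union> ?LU \<union> ?UL" if pq: "p \<in> V" "q \<in> V" "sees vs p q" "fst p < fst q" for p q
  proof -
    have vis: "vis l u p q"
      using sees_iff_vis[OF R, of "fst p" "fst q" "snd p" "snd q"] pq range by simp
    have c: "r \<in> VL \<and> r = (fst r, l (fst r)) \<and> fst r \<in> XL \<or> r \<in> VU \<and> r = (fst r, u (fst r)) \<and> fst r \<in> XU"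
      if "r \<in> V" for r
      using that VLU[of r] by (cases "r \<in> VL") (auto simp: VU_def VL_def XL_def XU_def prod_eq_iff)
    have mem: "{p, q} \<in> \<phi> f g ` F X f Y g"
      if "p = (fst p, f (fst p))" "fst p \<in> X" "q = (fst q, g (fst q))" "fst q \<in> Y" for f g X Y
    proof (rule image_eqI)
      show "{p, q} = \<phi> f g (fst p, fst q)" unfolding \<phi>_def using that(1,3) by simp
      show "(fst p, fst q) \<in> F X f Y g" unfolding F_def using that pq(4) vis by simp
    qed
    show ?thesis using c[OF pq(1)] c[OF pq(2)] mem by blast
  qed
  have cover: "vis_edges vs V \<subseteq> ?U \<union> ?L \<union> ?LU \<union> ?UL \<union> ?V"
  proof
    fix e assume "e \<in> vis_edges vs V"
    then obtain p q where e: "e = {p, q}" and pq: "p \<in> V" "q \<in> V" "p \<noteq> q" "sees vs p q"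
      by (auto simp: vis_edges_def)
    have qp: "sees vs q p" using pq(4) by (simp add: sees_def closed_segment_commute)
    consider "fst p < fst q" | "fst q < fst p" | "fst p = fst q" by linarith
    then show "e \<in> ?U \<union> ?L \<union> ?LU \<union> ?UL \<union> ?V"
    proof cases
      case 1
      then show ?thesis using ordered pq e by blast
    next
      case 2
      then show ?thesis using ordered[OF pq(2,1) qp] e by (simp add: insert_commute)
    next
      case 3
      \<comment> \<open>Two points on one vertical line lie on different chains, so such pairs are
        determined by an abscissa in \<open>XL\<close>.\<close>
      have ny: "snd p \<noteq> snd q" using pq(3) 3 by (auto simp: prod_eq_iff)
      have h: "\<exists>x\<in>XL. {p', q'} = {(x, l x), (x, u x)}"
        if "p' \<in> VL" "q' \<in> VU" "fst p' = fst q'" for p' q'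
      proof (intro bexI)
        show "fst p' \<in> XL" unfolding XL_def using that(1) by (rule imageI)
        have "p' = (fst p', l (fst p'))" "q' = (fst p', u (fst p'))"
          using that VLU[of q'] by (auto simp: VL_def prod_eq_iff)
        then show "{p', q'} = {(fst p', l (fst p')), (fst p', u (fst p'))}" by simp
      qed
      have "p \<in> VL \<and> q \<in> VU \<or> q \<in> VL \<and> p \<in> VU"
      proof -
        have "\<not> (p \<in> VL \<and> q \<in> VL)" using ny 3 by (auto simp: VL_def)
        moreover have "\<not> (p \<in> VU \<and> q \<in> VU)" using ny 3 VLU[of p] VLU[of q] by auto
        ultimately show ?thesis using pq(1,2) unfolding VU_def by blast
      qed
      then have "\<exists>x\<in>XL. e = {(x, l x), (x, u x)}"
        using h[of p q] h[of q p] 3 e by (auto simp: insert_commute)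
      then show ?thesis by blast
    qed
  qed
  have "card (vis_edges vs V) \<le> card (?U \<union> ?L \<union> ?LU \<union> ?UL \<union> ?V)"
    using cover fin finF by (intro card_mono) auto
  also have "\<dots> \<le> card ?U + card ?L + card ?LU + card ?UL + card ?V"
    by (meson add_le_mono1 card_Un_le le_trans)
  also have "\<dots> \<le> card (F XU u XU u) + card (F XL l XL l) + card (F XL l XU u) + card (F XU u XL l) + card XL"
    using fin finF by (intro add_mono card_image_le) auto
  also have "\<dots> \<le> edge_bound t * card XU + edge_bound t * card XL + edge_bound t * (card XL + card XU)
      + edge_bound t * (card XU + card XL) + (card XL + card XU)"
    using UU LL LU UL by simp
  \<comment> \<open>One \<open>edge_bound t\<close> comes from the edges within the chains, two come
    from the two directions between the chains, and the summand 1 pays for the vertical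
    pairs.\<close>
  also have "\<dots> = (3 * edge_bound t + 1) * (card XL + card XU)" by (simp add: algebra_simps)
  also have "\<dots> \<le> (3 * edge_bound t + 1) * card V"
  proof (rule mult_le_mono2)
    have "VL \<subseteq> V" by (auto simp: VL_def)
    then have "card VL + card VU = card V"
      unfolding VU_def using assms(3) by (metis card_Diff_subset card_mono finite_subset le_add_diff_inverse)
    moreover have "card XL \<le> card VL" "card XU \<le> card VU"
      using assms(3) by (auto simp: XL_def XU_def VL_def VU_def intro!: card_image_le)
    ultimately show "card XL + card XU \<le> card V" by linarith
  qed
  finally show ?thesis .
qed

theorem theorem1p3:
  fixes t :: nat
  assumes "t > 0"
  shows "\<exists>C::real. \<forall>(vs::pt list) (V::pt set).
           simple_polygon vs \<and> x_monotone vs \<and> finite V \<and> V \<subseteq> poly_boundary vs \<and>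
           \<not> contains_Ktt vs V t
           \<longrightarrow> real (card (vis_edges vs V)) \<le> C * real (card V)"
proof (intro exI allI impI, elim conjE)
  fix vs V
  assume "simple_polygon vs" "x_monotone vs" "finite V" "V \<subseteq> poly_boundary vs" "\<not> contains_Ktt vs V t"
  then have "card (vis_edges vs V) \<le> (3 * edge_bound t + 1) * card V"
    using card_vis_edges_le assms by blast
  then show "real (card (vis_edges vs V)) \<le> real (3 * edge_bound t + 1) * real (card V)"
    by (metis of_nat_le_iff of_nat_mult)
qed

end
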